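(* Let $A$ be a finite dimensional Hopf algebra over a field $k$ and let $M$ be a finite dimensional left $A$-module. Then $$\bigcap_{n\ge 0}\mathrm{Ann}_A(M^{\otimes n})=\omega(\mathrm{LKer}_M)\,A .$$
   Context: Sweedler notation $\Delta(a)=a_1\otimes a_2$ with summation omitted; $\epsilon$ is the counit. The left kernel of $M$ is $\mathrm{LKer}_M=\{a\in A : a_1\otimes a_2m=a\otimes m \text{ in } A\otimes M\ \forall m\in M\}$, a subalgebra of $A$. For a subalgebra $B\subset A$, $\omega(B)=B^+=B\cap\ker\epsilon$. Tensor powers carry the diagonal action, and $M^{\otimes 0}=k$ is the trivial module. *)

theory Defs
  imports Complex_Main "HOL-Library.Poly_Mapping"
begin

text \<open>The free vector space on a set of symbols is the type of finitely supported functions;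
  \<open>lin_ext s f\<close> is the linear map sending the basis vector \<open>basic p\<close> to \<open>f p\<close>, where \<open>s\<close> is the
  scalar multiplication of the target.\<close>

abbreviation basic :: "'x \<Rightarrow> ('x \<Rightarrow>\<^sub>0 'k::field)" where
  "basic p \<equiv> Poly_Mapping.single p 1"

definition fscale :: "'k::field \<Rightarrow> ('x \<Rightarrow>\<^sub>0 'k) \<Rightarrow> ('x \<Rightarrow>\<^sub>0 'k)" where
  "fscale c x = Poly_Mapping.map ((*) c) x"

definition lin_ext :: "('k::field \<Rightarrow> 'u \<Rightarrow> 'u) \<Rightarrow> ('x \<Rightarrow> 'u) \<Rightarrow> ('x \<Rightarrow>\<^sub>0 'k) \<Rightarrow> 'u::comm_monoid_add" where
  "lin_ext s f x = (\<Sum>p\<in>Poly_Mapping.keys x. s (Poly_Mapping.lookup x p) (f p))"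

lemma lookup_fscale [simp]:
  "Poly_Mapping.lookup (fscale c x) p = c * Poly_Mapping.lookup x p"
  unfolding fscale_def by transfer (simp add: when_def)

lemma vector_space_fscale: "vector_space fscale"
  by unfold_locales (auto intro!: poly_mapping_eqI simp: lookup_add algebra_simps)

lemma lin_ext_superset:
  assumes "vector_space s" "finite K" "Poly_Mapping.keys x \<subseteq> K"
  shows "lin_ext s f x = (\<Sum>p\<in>K. s (Poly_Mapping.lookup x p) (f p))"
proof -
  interpret vector_space s by fact
  show ?thesis
    unfolding lin_ext_def using assms(2,3)
    by (intro sum.mono_neutral_left) (auto simp: in_keys_iff)
qed

lemma linear_lin_ext:
  assumes "vector_space s"
  shows "Vector_Spaces.linear fscale s (lin_ext s f)"
proof -
  interpret F: vector_space fscale by (rule vector_space_fscale)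
  interpret U: vector_space s by fact
  show ?thesis
  proof (unfold_locales, goal_cases)
    case (1 x y)
    let ?K = "Poly_Mapping.keys x \<union> Poly_Mapping.keys y"
    have "Poly_Mapping.keys (x + y) \<subseteq> ?K" by (rule Poly_Mapping.keys_add)
    then show ?case
      by (simp add: lin_ext_superset[OF assms, where K = ?K] lookup_add U.scale_left_distrib
          sum.distrib)
  next
    case (2 c x)
    have "Poly_Mapping.keys (fscale c x) \<subseteq> Poly_Mapping.keys x"
      by (auto simp: in_keys_iff)
    then show ?case
      by (simp add: lin_ext_superset[OF assms, where K = "Poly_Mapping.keys x"]
          U.scale_sum_right)
  qed
qed

lemma lin_ext_basic [simp]:
  assumes "vector_space s"
  shows "lin_ext s f (basic p) = f p"
proof -
  interpret vector_space s by fact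
  show ?thesis by (simp add: lin_ext_def)
qed

text \<open>\<open>V \<otimes> W\<close> is the free vector space on \<open>V \<times> W\<close> modulo the span of the bilinearity relations;
  its elements are cosets of formal sums of pairs.\<close>

definition tensor_rels ::
  "('k::field \<Rightarrow> 'v \<Rightarrow> 'v) \<Rightarrow> ('k \<Rightarrow> 'w \<Rightarrow> 'w) \<Rightarrow> ('v::ab_group_add \<times> 'w::ab_group_add \<Rightarrow>\<^sub>0 'k) set" where
  "tensor_rels sV sW =
     {basic (v + v', w) - basic (v, w) - basic (v', w) | v v' w. True} \<union>
     {basic (v, w + w') - basic (v, w) - basic (v, w') | v w w'. True} \<union>
     {basic (sV c v, w) - fscale c (basic (v, w)) | c v w. True} \<union>
     {basic (v, sW c w) - fscale c (basic (v, w)) | c v w. True}"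

definition tensor_null ::
  "('k::field \<Rightarrow> 'v \<Rightarrow> 'v) \<Rightarrow> ('k \<Rightarrow> 'w \<Rightarrow> 'w) \<Rightarrow> ('v::ab_group_add \<times> 'w::ab_group_add \<Rightarrow>\<^sub>0 'k) set" where
  "tensor_null sV sW = module.span fscale (tensor_rels sV sW)"

definition tensor_class ::
  "('k::field \<Rightarrow> 'v \<Rightarrow> 'v) \<Rightarrow> ('k \<Rightarrow> 'w \<Rightarrow> 'w) \<Rightarrow> ('v::ab_group_add \<times> 'w::ab_group_add \<Rightarrow>\<^sub>0 'k) \<Rightarrow>
   ('v \<times> 'w \<Rightarrow>\<^sub>0 'k) set" where
  "tensor_class sV sW x = {y. y - x \<in> tensor_null sV sW}"

definition tensor_space ::
  "('k::field \<Rightarrow> 'v \<Rightarrow> 'v) \<Rightarrow> ('k \<Rightarrow> 'w \<Rightarrow> 'w) \<Rightarrow> ('v::ab_group_add \<times> 'w::ab_group_add \<Rightarrow>\<^sub>0 'k) set set" where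
  "tensor_space sV sW = range (tensor_class sV sW)"

text \<open>\<open>V\<^sup>\<otimes>\<^sup>n\<close> is the free vector space on \<open>n\<close>-tuples of vectors (lists of length \<open>n\<close>) modulo the span
  of the multilinearity relations. For \<open>n = 0\<close> there is one tuple and no relation, so this is the
  one-dimensional space spanned by \<open>basic []\<close>.\<close>

definition tpow_rels ::
  "('k::field \<Rightarrow> 'v \<Rightarrow> 'v) \<Rightarrow> nat \<Rightarrow> ('v::ab_group_add list \<Rightarrow>\<^sub>0 'k) set" where
  "tpow_rels s n =
     {basic (us @ (v + v') # vs) - basic (us @ v # vs) - basic (us @ v' # vs) | us v v' vs.
        Suc (length us + length vs) = n} \<union>
     {basic (us @ s c v # vs) - fscale c (basic (us @ v # vs)) | us c v vs.
        Suc (length us + length vs) = n}"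

definition tpow_null ::
  "('k::field \<Rightarrow> 'v \<Rightarrow> 'v) \<Rightarrow> nat \<Rightarrow> ('v::ab_group_add list \<Rightarrow>\<^sub>0 'k) set" where
  "tpow_null s n = module.span fscale (tpow_rels s n)"

definition tpow_class ::
  "('k::field \<Rightarrow> 'v \<Rightarrow> 'v) \<Rightarrow> nat \<Rightarrow> ('v::ab_group_add list \<Rightarrow>\<^sub>0 'k) \<Rightarrow> ('v list \<Rightarrow>\<^sub>0 'k) set" where
  "tpow_class s n x = {y. y - x \<in> tpow_null s n}"

definition tpow_space ::
  "('k::field \<Rightarrow> 'v \<Rightarrow> 'v) \<Rightarrow> nat \<Rightarrow> ('v::ab_group_add list \<Rightarrow>\<^sub>0 'k) set set" where
  "tpow_space s n = tpow_class s n ` {x. \<forall>l\<in>Poly_Mapping.keys x. length l = n}"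

definition rep :: "'x set \<Rightarrow> 'x" where
  "rep X = (SOME x. x \<in> X)"

lemma tensor_class_eq_iff:
  fixes sV :: "'k::field \<Rightarrow> 'v::ab_group_add \<Rightarrow> 'v" and sW :: "'k \<Rightarrow> 'w::ab_group_add \<Rightarrow> 'w"
  shows "tensor_class sV sW x = tensor_class sV sW y \<longleftrightarrow> x - y \<in> tensor_null sV sW"
proof -
  interpret F: vector_space "fscale :: 'k \<Rightarrow> ('v \<times> 'w \<Rightarrow>\<^sub>0 'k) \<Rightarrow> _" by (rule vector_space_fscale)
  have *: "z - x \<in> tensor_null sV sW \<longleftrightarrow> z - y \<in> tensor_null sV sW"
    if "x - y \<in> tensor_null sV sW" for z
    using F.span_add[of "z - x" "tensor_rels sV sW" "x - y"]
      F.span_diff[of "z - y" "tensor_rels sV sW" "x - y"] that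
    by (auto simp: tensor_null_def)
  have "x \<in> tensor_class sV sW x"
    by (simp add: tensor_class_def tensor_null_def F.span_zero)
  then show ?thesis
    using * by (auto simp: tensor_class_def)
qed

lemma tensor_class_rep:
  fixes sV :: "'k::field \<Rightarrow> 'v::ab_group_add \<Rightarrow> 'v" and sW :: "'k \<Rightarrow> 'w::ab_group_add \<Rightarrow> 'w"
  assumes "X \<in> tensor_space sV sW"
  shows "tensor_class sV sW (rep X) = X"
proof -
  interpret F: vector_space "fscale :: 'k \<Rightarrow> ('v \<times> 'w \<Rightarrow>\<^sub>0 'k) \<Rightarrow> _" by (rule vector_space_fscale)
  obtain x where x: "X = tensor_class sV sW x"
    using assms by (auto simp: tensor_space_def)
  then have "x \<in> X"
    by (simp add: tensor_class_def tensor_null_def F.span_zero)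
  then have "rep X \<in> X" unfolding rep_def by (rule someI)
  then show ?thesis
    using tensor_class_eq_iff[of sV sW "rep X" x] x by (simp add: tensor_class_def)
qed

lemma lin_ext_tensor_null:
  assumes s: "vector_space s" and N: "module.subspace s N"
    and "\<And>v v' w. f (v + v', w) - f (v, w) - f (v', w) \<in> N"
    and "\<And>v w w'. f (v, w + w') - f (v, w) - f (v, w') \<in> N"
    and "\<And>c v w. f (sV c v, w) - s c (f (v, w)) \<in> N"
    and "\<And>c v w. f (v, sW c w) - s c (f (v, w)) \<in> N"
    and x: "x \<in> tensor_null sV sW"
  shows "lin_ext s f x \<in> N"
proof -
  interpret L: Vector_Spaces.linear fscale s "lin_ext s f" by (rule linear_lin_ext[OF s])
  have "lin_ext s f ` tensor_rels sV sW \<subseteq> N"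
    using assms(3-6) s by (auto simp: tensor_rels_def L.diff L.scale)
  then have "L.vs2.span (lin_ext s f ` tensor_rels sV sW) \<subseteq> N"
    using N by (rule L.vs2.span_minimal)
  then show ?thesis
    using x L.span_image[of "tensor_rels sV sW"] by (auto simp: tensor_null_def)
qed

text \<open>\<open>sweedler s D f\<close> is the sum of \<open>f x y\<close> over \<open>x \<otimes> y\<close> occurring in a formal sum that represents the
  tensor \<open>D\<close>. It is used for \<open>D = comult a\<close>, where it reads as the Sweedler sum of \<open>f a\<^sub>1 a\<^sub>2\<close>, and
  only for \<open>f\<close> that are bilinear (or bilinear modulo a subspace by which the result is then divided),
  so that the choice of representative is irrelevant: see \<open>sweedler_cong\<close>.\<close>

definition sweedler ::
  "('k::field \<Rightarrow> 'u \<Rightarrow> 'u) \<Rightarrow> ('v \<times> 'w \<Rightarrow>\<^sub>0 'k) set \<Rightarrow> ('v \<Rightarrow> 'w \<Rightarrow> 'u) \<Rightarrow> 'u::comm_monoid_add" where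
  "sweedler s D f = lin_ext s (\<lambda>(x, y). f x y) (rep D)"

lemma sweedler_cong:
  assumes s: "vector_space s" and N: "module.subspace s N"
    and "\<And>v v' w. f (v + v') w - f v w - f v' w \<in> N"
    and "\<And>v w w'. f v (w + w') - f v w - f v w' \<in> N"
    and "\<And>c v w. f (sV c v) w - s c (f v w) \<in> N"
    and "\<And>c v w. f v (sW c w) - s c (f v w) \<in> N"
    and D: "D \<in> tensor_space sV sW" "t \<in> D"
  shows "sweedler s D f - lin_ext s (\<lambda>(x, y). f x y) t \<in> N"
proof -
  let ?g = "\<lambda>(x, y). f x y"
  interpret L: Vector_Spaces.linear fscale s "lin_ext s ?g" by (rule linear_lin_ext[OF s])
  have "t - rep D \<in> tensor_null sV sW"
    using D tensor_class_rep[OF D(1)] by (auto simp: tensor_class_def)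
  then have "rep D - t \<in> tensor_null sV sW"
    unfolding tensor_null_def by (metis L.vs1.span_neg minus_diff_eq)
  then have "lin_ext s ?g (rep D - t) \<in> N"
    using assms(3-6) by (intro lin_ext_tensor_null[OF s N]) auto
  then show ?thesis by (simp add: sweedler_def L.diff)
qed

locale coalgebra = vector_space scale
  for scale :: "'k::field \<Rightarrow> 'a::ab_group_add \<Rightarrow> 'a" +
  fixes comult :: "'a \<Rightarrow> ('a \<times> 'a \<Rightarrow>\<^sub>0 'k) set"
    and counit :: "'a \<Rightarrow> 'k"
  assumes comult_in: "comult a \<in> tensor_space scale scale"
    and comult_add: "comult (a + b) = tensor_class scale scale (rep (comult a) + rep (comult b))"
    and comult_scale: "comult (scale c a) = tensor_class scale scale (fscale c (rep (comult a)))"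
    and counit_linear: "Vector_Spaces.linear scale (*) counit"
    and coassoc:
      "tpow_class scale 3 (sweedler fscale (comult a) (\<lambda>x y.
         sweedler fscale (comult x) (\<lambda>p q. basic [p, q, y]))) =
       tpow_class scale 3 (sweedler fscale (comult a) (\<lambda>x y.
         sweedler fscale (comult y) (\<lambda>p q. basic [x, p, q])))"
    and counit_left: "sweedler scale (comult a) (\<lambda>x y. scale (counit x) y) = a"
    and counit_right: "sweedler scale (comult a) (\<lambda>x y. scale (counit y) x) = a"

locale unital_algebra = vector_space scale
  for scale :: "'k::field \<Rightarrow> 'a::ring_1 \<Rightarrow> 'a" +
  assumes scale_mult_left: "scale c a * b = scale c (a * b)"
    and scale_mult_right: "a * scale c b = scale c (a * b)"

locale bialgebra = unital_algebra scale + coalgebra scale comult counit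
  for scale :: "'k::field \<Rightarrow> 'a::ring_1 \<Rightarrow> 'a"
    and comult :: "'a \<Rightarrow> ('a \<times> 'a \<Rightarrow>\<^sub>0 'k) set"
    and counit :: "'a \<Rightarrow> 'k" +
  assumes comult_mult:
      "comult (a * b) = tensor_class scale scale
         (sweedler fscale (comult a) (\<lambda>x y. sweedler fscale (comult b) (\<lambda>p q. basic (x * p, y * q))))"
    and comult_one: "comult 1 = tensor_class scale scale (basic (1, 1))"
    and counit_mult: "counit (a * b) = counit a * counit b"
    and counit_one: "counit 1 = 1"

locale hopf_algebra = bialgebra scale comult counit
  for scale :: "'k::field \<Rightarrow> 'a::ring_1 \<Rightarrow> 'a"
    and comult :: "'a \<Rightarrow> ('a \<times> 'a \<Rightarrow>\<^sub>0 'k) set"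
    and counit :: "'a \<Rightarrow> 'k" +
  fixes antipode :: "'a \<Rightarrow> 'a"
  assumes antipode_linear: "Vector_Spaces.linear scale scale antipode"
    and antipode_left: "sweedler scale (comult a) (\<lambda>x y. antipode x * y) = scale (counit a) 1"
    and antipode_right: "sweedler scale (comult a) (\<lambda>x y. x * antipode y) = scale (counit a) 1"

locale left_module = A: unital_algebra scale + M: vector_space scaleM
  for scale :: "'k::field \<Rightarrow> 'a::ring_1 \<Rightarrow> 'a"
    and scaleM :: "'k \<Rightarrow> 'm::ab_group_add \<Rightarrow> 'm" +
  fixes act :: "'a \<Rightarrow> 'm \<Rightarrow> 'm"
  assumes act_linear_left: "Vector_Spaces.linear scale scaleM (\<lambda>a. act a m)"
    and act_linear_right: "Vector_Spaces.linear scaleM scaleM (act a)"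
    and act_mult: "act (a * b) m = act a (act b m)"
    and act_one: "act 1 m = m"

definition LKer ::
  "('k::field \<Rightarrow> 'a \<Rightarrow> 'a) \<Rightarrow> ('a::ring_1 \<Rightarrow> ('a \<times> 'a \<Rightarrow>\<^sub>0 'k) set) \<Rightarrow>
   ('k \<Rightarrow> 'm \<Rightarrow> 'm) \<Rightarrow> ('a \<Rightarrow> 'm \<Rightarrow> 'm::ab_group_add) \<Rightarrow> 'a set" where
  "LKer scale comult scaleM act =
     {a. \<forall>m. tensor_class scale scaleM (sweedler fscale (comult a) (\<lambda>x y. basic (x, act y m))) =
             tensor_class scale scaleM (basic (a, m))}"

definition omega :: "('a \<Rightarrow> 'k::field) \<Rightarrow> 'a set \<Rightarrow> 'a set" where
  "omega counit B = B \<inter> {a. counit a = 0}"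

text \<open>The product of two subspaces is the span of the elementwise products.\<close>

definition subspace_mult :: "('k::field \<Rightarrow> 'a \<Rightarrow> 'a) \<Rightarrow> 'a set \<Rightarrow> 'a set \<Rightarrow> 'a::ring_1 set" where
  "subspace_mult scale X Y = module.span scale {x * y | x y. x \<in> X \<and> y \<in> Y}"

text \<open>The diagonal action \<open>a \<cdot> (m\<^sub>1 \<otimes> \<dots> \<otimes> m\<^sub>n) = a\<^sub>1 m\<^sub>1 \<otimes> \<dots> \<otimes> a\<^sub>n m\<^sub>n\<close> on formal pure tensors, by
  \<open>a \<cdot> (m \<otimes> t) = a\<^sub>1 m \<otimes> a\<^sub>2 \<cdot> t\<close> and \<open>a \<cdot> 1 = \<epsilon>(a) 1\<close> on the trivial module.\<close>

primrec diag_act ::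
  "('a \<Rightarrow> ('a \<times> 'a \<Rightarrow>\<^sub>0 'k) set) \<Rightarrow> ('a \<Rightarrow> 'k::field) \<Rightarrow> ('a \<Rightarrow> 'm \<Rightarrow> 'm) \<Rightarrow>
   'm list \<Rightarrow> 'a \<Rightarrow> ('m list \<Rightarrow>\<^sub>0 'k)" where
  "diag_act comult counit act [] = (\<lambda>a. fscale (counit a) (basic []))"
| "diag_act comult counit act (m # ms) =
     (\<lambda>a. sweedler fscale (comult a) (\<lambda>x y.
        lin_ext fscale (\<lambda>l. basic (act x m # l)) (diag_act comult counit act ms y)))"

definition tpow_act ::
  "('a \<Rightarrow> ('a \<times> 'a \<Rightarrow>\<^sub>0 'k) set) \<Rightarrow> ('a \<Rightarrow> 'k::field) \<Rightarrow> ('k \<Rightarrow> 'm \<Rightarrow> 'm) \<Rightarrow>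
   ('a \<Rightarrow> 'm \<Rightarrow> 'm) \<Rightarrow> nat \<Rightarrow> 'a \<Rightarrow> ('m list \<Rightarrow>\<^sub>0 'k) set \<Rightarrow> ('m::ab_group_add list \<Rightarrow>\<^sub>0 'k) set" where
  "tpow_act comult counit scaleM act n a T =
     tpow_class scaleM n (lin_ext fscale (\<lambda>l. diag_act comult counit act l a) (rep T))"

definition tpow_Ann ::
  "('a \<Rightarrow> ('a \<times> 'a \<Rightarrow>\<^sub>0 'k) set) \<Rightarrow> ('a \<Rightarrow> 'k::field) \<Rightarrow> ('k \<Rightarrow> 'm \<Rightarrow> 'm) \<Rightarrow>
   ('a \<Rightarrow> 'm \<Rightarrow> 'm::ab_group_add) \<Rightarrow> nat \<Rightarrow> 'a set" where
  "tpow_Ann comult counit scaleM act n =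
     {a. \<forall>T\<in>tpow_space scaleM n. tpow_act comult counit scaleM act n a T = tpow_class scaleM n 0}"

end

theory Submission
  imports Defs "HOL-Library.Function_Algebras"
begin

text \<open>Let \<open>I\<close> be the common annihilator of the tensor powers of \<open>M\<close>. Over the finite-dimensional space \<open>M\<close>, an
  element of \<open>A\<close> lies in \<open>I\<close> if and only if all products \<open>c\<^sub>1 * \<dots> * c\<^sub>n\<close> of matrix coefficients
  \<open>c(a) = \<phi>(a m)\<close> vanish on it (\<open>mem_tpow_Ann_iff\<close>). Therefore \<open>I\<close> is a two-sided ideal and a coideal
  (\<open>bi_ideal_annihilator\<close>). Likewise an element \<open>b\<close> is in the left kernel if and only if
  \<open>b\<^sub>1 c(b\<^sub>2) = c(1) b\<close> for all matrix coefficients \<open>c\<close> of \<open>M\<close> (\<open>mem_LKer_iff\<close>). Such a \<open>b\<close> acts on every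
  tensor power as the scalar \<open>\<epsilon>(b)\<close>, which gives the inclusion of \<open>\<omega>(LKer) A\<close> in \<open>I\<close>.

  The converse is the statement that a bi-ideal \<open>I\<close> of a finite-dimensional Hopf algebra \<open>A\<close> is
  contained in \<open>B\<^sup>+ A\<close>, where \<open>B\<close> is the algebra of coinvariants of \<open>A \<rightarrow> A / I\<close>
  (\<open>bi_ideal_subset_coinvariants\<close>). The reason is a trace argument.
  The ideal \<open>I\<close> is stable under the antipode (\<open>antipode_I\<close>), so \<open>A / I\<close> is a Hopf
  algebra. For a left integral \<open>\<lambda>\<close> in its dual, the trace \<open>tr(y) = y\<^sub>1 \<lambda>(y\<^sub>2)\<close> has values in \<open>B\<close>. The dual
  of \<open>A / I\<close> is a Hopf module, and decomposing its element \<open>\<epsilon>\<close> along the projection onto the integrals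
  yields integrals \<open>\<lambda>\<^sub>d\<close>, indexed by a basis of \<open>A / I\<close>, with \<open>\<epsilon>(x) = \<Sum>\<^sub>d \<lambda>\<^sub>d(x S(d))\<close>
  (\<open>conv_trace_integral\<close>, \<open>sum_trace_integral\<close>). Hence, by the antipode identity \<open>hit_antipode\<close>,
  \<open>a = \<Sum>\<^sub>d a\<^sub>1 \<lambda>\<^sub>d(a\<^sub>2 S(d)) = \<Sum>\<^sub>d tr\<^sub>d(a S(d\<^sub>1)) d\<^sub>2\<close>
  for every \<open>a\<close> (\<open>trace_decomposition\<close>). If \<open>a \<in> I\<close>, then the elements \<open>tr\<^sub>d(a S(d\<^sub>1))\<close> of \<open>B\<close> have counit
  \<open>\<lambda>\<^sub>d(a S(d\<^sub>1)) = 0\<close>, so that \<open>a \<in> B\<^sup>+ A\<close>.\<close>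

section \<open>Linear maps and Sweedler sums\<close>

abbreviation lin where "lin \<equiv> Vector_Spaces.linear"

lemma vector_space_field: "vector_space ((*) :: 'k::field \<Rightarrow> 'k \<Rightarrow> 'k)"
  by unfold_locales (auto simp: algebra_simps)

lemma linI:
  assumes "vector_space s" "vector_space t"
    and "\<And>x y. f (x + y) = f x + f y" "\<And>c x. f (s c x) = t c (f x)"
  shows "lin s t f"
  using assms by (simp add: Vector_Spaces.linear_iff)

lemma lin_target: "lin s t f \<Longrightarrow> vector_space t"
  by (simp add: Vector_Spaces.linear_iff)

lemma lin_add: "lin s t f \<Longrightarrow> f (x + y) = f x + f y"
  by (simp add: Vector_Spaces.linear_iff)

lemma lin_scale: "lin s t f \<Longrightarrow> f (s c x) = t c (f x)"
  by (simp add: Vector_Spaces.linear_iff)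

lemma lin_zero: "lin s t f \<Longrightarrow> f 0 = 0"
  using lin_add[of s t f 0 0] by simp

lemma lin_diff: "lin s t f \<Longrightarrow> f (x - y) = f x - f y"
  using lin_add[of s t f "x - y" y] by simp

lemma lin_sum: "lin s t f \<Longrightarrow> f (\<Sum>i\<in>X. g i) = (\<Sum>i\<in>X. f (g i))"
  by (induction X rule: infinite_finite_induct) (simp_all add: lin_zero lin_add)

lemma lin_compose: "lin t u f \<Longrightarrow> lin s t g \<Longrightarrow> lin s u (\<lambda>x. f (g x))"
  by (simp add: Vector_Spaces.linear_iff)

lemma lin_ident: "vector_space s \<Longrightarrow> lin s s (\<lambda>x. x)"
  by (simp add: Vector_Spaces.linear_iff)

lemma lin_sumI:
  assumes "vector_space s" "vector_space t" "\<And>i. i \<in> X \<Longrightarrow> lin s t (\<lambda>x. f x i)"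
  shows "lin s t (\<lambda>x. \<Sum>i\<in>X. f x i)"
proof -
  interpret vector_space t by fact
  show ?thesis
    using assms(1,2) lin_add[OF assms(3)] lin_scale[OF assms(3)]
    by (intro linI) (simp_all add: sum.distrib[symmetric] scale_sum_right)
qed

lemma lin_scale_const:
  assumes "lin s t f" shows "lin s t (\<lambda>x. t c (f x))"
proof -
  interpret vector_space t using assms by (rule lin_target)
  show ?thesis
    using assms
    by (simp add: Vector_Spaces.linear_iff scale_right_distrib scale_left_commute)
qed

lemma lin_scale_vec:
  assumes "lin s (*) f" "vector_space t" shows "lin s t (\<lambda>x. t (f x) v)"
proof -
  interpret vector_space t by fact
  show ?thesis
    using assms
    by (simp add: Vector_Spaces.linear_iff scale_left_distrib)
qed

lemma lin_mult_left: "lin s (*) f \<Longrightarrow> lin s (*) (\<lambda>x. c * f x)"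
  by (rule lin_scale_const)

lemma lin_mult_right: "lin s (*) f \<Longrightarrow> lin s (*) (\<lambda>x. f x * c)"
  using lin_mult_left[of s f c] by (simp add: mult.commute)

lemma lin_ext_image:
  assumes "lin s t L" "vector_space s"
  shows "L (lin_ext s f x) = lin_ext t (\<lambda>p. L (f p)) x"
  unfolding lin_ext_def using assms by (simp add: lin_sum lin_scale)

lemma lin_ext_fun_add:
  assumes "vector_space s"
  shows "lin_ext s (\<lambda>p. f p + g p) x = lin_ext s f x + lin_ext s g x"
proof -
  interpret vector_space s by fact
  show ?thesis unfolding lin_ext_def by (simp add: scale_right_distrib sum.distrib)
qed

lemma lin_ext_swap:
  assumes "vector_space s"
  shows "lin_ext s (\<lambda>p. lin_ext s (\<lambda>q. f p q) y) x = lin_ext s (\<lambda>q. lin_ext s (\<lambda>p. f p q) x) y"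
proof -
  interpret vector_space s by fact
  show ?thesis
    unfolding lin_ext_def scale_sum_right
    by (subst sum.swap) (simp add: mult.commute)
qed

lemma lin_ext_const_scale:
  assumes "vector_space s" shows "lin_ext s (\<lambda>p. s c (f p)) x = s c (lin_ext s f x)"
proof -
  interpret vector_space s by fact
  show ?thesis unfolding lin_ext_def by (simp add: scale_sum_right mult.commute)
qed

lemma lin_lin_ext_fun:
  assumes "vector_space s" "vector_space t" "\<And>p. lin t s (\<lambda>z. f z p)"
  shows "lin t s (\<lambda>z. lin_ext s (f z) x)"
proof (rule linI[OF assms(2,1)])
  fix u v c
  have "f (u + v) = (\<lambda>p. f u p + f v p)" "f (t c u) = (\<lambda>p. s c (f u p))"
    by (auto simp: lin_add[OF assms(3)] lin_scale[OF assms(3)])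
  then show "lin_ext s (f (u + v)) x = lin_ext s (f u) x + lin_ext s (f v) x"
    "lin_ext s (f (t c u)) x = s c (lin_ext s (f u) x)"
    using assms(1) by (simp_all add: lin_ext_fun_add lin_ext_const_scale)
qed

lemma lin_ext_mem:
  assumes "vector_space s" "module.subspace s N" "\<And>p. p \<in> Poly_Mapping.keys x \<Longrightarrow> f p \<in> N"
  shows "lin_ext s f x \<in> N"
proof -
  interpret vector_space s by fact
  show ?thesis
    unfolding lin_ext_def using assms(2,3) by (intro subspace_sum subspace_scale) auto
qed

lemma lin_ext_basic_self:
  fixes x :: "'x \<Rightarrow>\<^sub>0 'k::field"
  shows "lin_ext fscale basic x = x"
proof (rule poly_mapping_eqI)
  fix k
  have "lin fscale (*) (\<lambda>x :: 'x \<Rightarrow>\<^sub>0 'k. Poly_Mapping.lookup x k)"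
    by (intro linI vector_space_fscale vector_space_field) (auto simp: lookup_add)
  then have "Poly_Mapping.lookup (lin_ext fscale basic x) k =
      lin_ext (*) (\<lambda>p. Poly_Mapping.lookup (basic p) k) x"
    by (rule lin_ext_image) (rule vector_space_fscale)
  also have "\<dots> = (\<Sum>p\<in>Poly_Mapping.keys x. if p = k then Poly_Mapping.lookup x k else 0)"
    unfolding lin_ext_def by (rule sum.cong) (auto simp: lookup_single when_def)
  also have "\<dots> = Poly_Mapping.lookup x k"
    by (simp add: sum.delta in_keys_iff)
  finally show "Poly_Mapping.lookup (lin_ext fscale basic x) k = Poly_Mapping.lookup x k" .
qed

lemma sweedler_image:
  assumes "lin s t L"
  shows "L (sweedler s D f) = sweedler t D (\<lambda>x y. L (f x y))"
proof -
  have "vector_space s" using assms by (simp add: Vector_Spaces.linear_iff)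
  then show ?thesis
    unfolding sweedler_def using assms
    by (subst lin_ext_image) (auto intro!: arg_cong[of _ _ "\<lambda>f. lin_ext t f (rep D)"])
qed

lemma sweedler_swap:
  assumes "vector_space s"
  shows "sweedler s D (\<lambda>x y. sweedler s E (\<lambda>p q. f x y p q)) =
         sweedler s E (\<lambda>p q. sweedler s D (\<lambda>x y. f x y p q))"
  unfolding sweedler_def using lin_ext_swap[OF assms, of "\<lambda>p q. f (fst p) (snd p) (fst q) (snd q)"]
  by (simp add: case_prod_unfold)

lemma lin_sweedler_fun:
  assumes "vector_space s" "vector_space t" "\<And>x y. lin t s (\<lambda>z. f z x y)"
  shows "lin t s (\<lambda>z. sweedler s D (f z))"
  unfolding sweedler_def using assms by (intro lin_lin_ext_fun) (auto simp: case_prod_unfold)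

lemma sweedler_fun_add:
  assumes "vector_space s"
  shows "sweedler s D (\<lambda>x y. f x y + g x y) = sweedler s D f + sweedler s D g"
  unfolding sweedler_def using lin_ext_fun_add[OF assms, of "\<lambda>(x, y). f x y" "\<lambda>(x, y). g x y"]
  by (simp add: case_prod_unfold)

lemma sweedler_fun_sum:
  assumes "vector_space s"
  shows "sweedler s D (\<lambda>x y. \<Sum>i\<in>X. f i x y) = (\<Sum>i\<in>X. sweedler s D (f i))"
proof -
  interpret vector_space s by fact
  show ?thesis
    unfolding sweedler_def lin_ext_def by (subst sum.swap) (simp add: case_prod_unfold scale_sum_right)
qed

lemma sweedler_mult_left: "c * sweedler (*) D f = sweedler (*) D (\<lambda>x y. c * f x y)"
  by (rule sweedler_image) (intro lin_mult_left lin_ident vector_space_field)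

lemma sweedler_mult_right: "sweedler (*) D f * c = sweedler (*) D (\<lambda>x y. f x y * c)"
  by (rule sweedler_image) (intro lin_mult_right lin_ident vector_space_field)

lemma sweedler_mem:
  assumes "vector_space s" "module.subspace s N" "\<And>x y. f x y \<in> N"
  shows "sweedler s D f \<in> N"
  unfolding sweedler_def using assms by (intro lin_ext_mem) (auto simp: case_prod_unfold)

lemma subspace_zero: "vector_space s \<Longrightarrow> module.subspace s {0}"
  by (simp add: module.subspace_single_0 module_iff_vector_space)

lemma sweedler_rep:
  assumes "\<And>y. lin sV s (\<lambda>x. f x y)" "\<And>x. lin sW s (f x)"
    and D: "D \<in> tensor_space sV sW" "t \<in> D"
  shows "sweedler s D f = lin_ext s (\<lambda>(x, y). f x y) t"
proof -
  have s: "vector_space s" using assms(2) by (rule lin_target)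
  have "sweedler s D f - lin_ext s (\<lambda>(x, y). f x y) t \<in> {0}"
    by (rule sweedler_cong[OF s subspace_zero[OF s] _ _ _ _ D])
       (simp_all add: lin_add[OF assms(1)] lin_add[OF assms(2)] lin_scale[OF assms(1)] lin_scale[OF assms(2)])
  then show ?thesis by simp
qed

text \<open>For bilinear \<open>f\<close> a Sweedler sum may be evaluated on any representative of the tensor, in particular
  on the explicit ones in the axioms for \<open>\<Delta>(a + b)\<close>, \<open>\<Delta>(a b)\<close> and \<open>\<Delta>(1)\<close>.\<close>

lemma sweedler_class:
  fixes sV :: "'k::field \<Rightarrow> 'v::ab_group_add \<Rightarrow> 'v" and sW :: "'k \<Rightarrow> 'w::ab_group_add \<Rightarrow> 'w"
  assumes "\<And>y. lin sV s (\<lambda>x. f x y)" "\<And>x. lin sW s (f x)"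
  shows "sweedler s (tensor_class sV sW t) f = lin_ext s (\<lambda>(x, y). f x y) t"
proof (rule sweedler_rep[OF assms])
  interpret F: vector_space "fscale :: 'k \<Rightarrow> ('v \<times> 'w \<Rightarrow>\<^sub>0 'k) \<Rightarrow> _" by (rule vector_space_fscale)
  show "t \<in> tensor_class sV sW t"
    by (simp add: tensor_class_def tensor_null_def F.span_zero)
qed (auto simp: tensor_space_def)

text \<open>The universal property of \<open>V\<^sup>\<otimes>\<^sup>n\<close>: a function that is linear in each position extends to a linear map
  that vanishes on the multilinearity relations.\<close>

lemma lin_ext_tpow_null:
  assumes s: "vector_space s"
    and add: "\<And>us v v' vs. Suc (length us + length vs) = n \<Longrightarrow>
      f (us @ (v + v') # vs) = f (us @ v # vs) + f (us @ v' # vs)"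
    and scale: "\<And>us c v vs. Suc (length us + length vs) = n \<Longrightarrow>
      f (us @ sM c v # vs) = s c (f (us @ v # vs))"
    and x: "x \<in> tpow_null sM n"
  shows "lin_ext s f x = 0"
proof -
  interpret L: Vector_Spaces.linear fscale s "lin_ext s f" by (rule linear_lin_ext[OF s])
  have "lin_ext s f ` tpow_rels sM n \<subseteq> {0}"
    using s by (auto simp: tpow_rels_def L.diff L.scale add scale)
  then have "L.vs2.span (lin_ext s f ` tpow_rels sM n) \<subseteq> {0}"
    by (rule L.vs2.span_minimal) (rule L.vs2.subspace_single_0)
  then show ?thesis
    using x L.span_image[of "tpow_rels sM n"] by (auto simp: tpow_null_def)
qed

lemma tpow_class_eq_iff:
  fixes s :: "'k::field \<Rightarrow> 'm::ab_group_add \<Rightarrow> 'm"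
  shows
  "tpow_class s n x = tpow_class s n y \<longleftrightarrow> x - y \<in> tpow_null s n"
proof -
  interpret F: vector_space "fscale :: 'k \<Rightarrow> ('m list \<Rightarrow>\<^sub>0 'k) \<Rightarrow> _" by (rule vector_space_fscale)
  have *: "z - x \<in> tpow_null s n \<longleftrightarrow> z - y \<in> tpow_null s n"
    if "x - y \<in> tpow_null s n" for z
    using F.span_add[of "z - x" "tpow_rels s n" "x - y"]
      F.span_diff[of "z - y" "tpow_rels s n" "x - y"] that
    by (auto simp: tpow_null_def)
  have "x \<in> tpow_class s n x"
    by (simp add: tpow_class_def tpow_null_def F.span_zero)
  then show ?thesis
    using * by (auto simp: tpow_class_def)
qed

section \<open>Sweedler calculus in a coalgebra and a bialgebra\<close>

context coalgebra
begin

abbreviation sw where "sw s a f \<equiv> sweedler s (comult a) f"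

lemma lin_counit: "lin scale (*) counit"
  by (rule counit_linear)

lemma lin_id: "lin scale scale (\<lambda>x. x)"
  by (rule lin_ident) (rule vector_space_axioms)

lemma lin_sw_arg:
  assumes "\<And>y. lin scale s (\<lambda>x. f x y)" "\<And>x. lin scale s (f x)"
  shows "lin scale s (\<lambda>a. sw s a f)"
proof -
  have s: "vector_space s" using assms(2) by (rule lin_target)
  interpret L: Vector_Spaces.linear fscale s "lin_ext s (\<lambda>(x, y). f x y)" by (rule linear_lin_ext[OF s])
  show ?thesis
  proof (rule linI[OF vector_space_axioms s])
    fix x y c
    show "sw s (x + y) f = sw s x f + sw s y f"
      unfolding comult_add sweedler_class[OF assms] L.add by (simp add: sweedler_def)
    show "sw s (scale c x) f = s c (sw s x f)"
      unfolding comult_scale sweedler_class[OF assms] L.scale by (simp add: sweedler_def)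
  qed
qed

lemma lin_sw_compose:
  assumes "\<And>y. lin scale s (\<lambda>x. f x y)" "\<And>x. lin scale s (f x)" "lin t scale g"
  shows "lin t s (\<lambda>z. sw s (g z) f)"
  by (rule lin_compose[OF lin_sw_arg assms(3)]) (rule assms)+

lemma sw_counit_left:
  assumes "lin scale s g"
  shows "sw s a (\<lambda>x y. s (counit x) (g y)) = g a"
  using sweedler_image[OF assms, of "comult a" "\<lambda>x y. scale (counit x) y"]
  by (simp add: counit_left lin_scale[OF assms])

lemma sw_counit_right:
  assumes "lin scale s g"
  shows "sw s a (\<lambda>x y. s (counit y) (g x)) = g a"
  using sweedler_image[OF assms, of "comult a" "\<lambda>x y. scale (counit y) x"]
  by (simp add: counit_right lin_scale[OF assms])

text \<open>The axiom is coassociativity for the universal trilinear map \<open>(x, y, z) \<mapsto> x \<otimes> y \<otimes> z\<close>; every trilinear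
  \<open>f\<close> factors through it.\<close>

lemma sw_coassoc:
  assumes "\<And>y z. lin scale s (\<lambda>x. f x y z)" "\<And>x z. lin scale s (\<lambda>y. f x y z)"
    "\<And>x y. lin scale s (\<lambda>z. f x y z)"
  shows "sw s a (\<lambda>x z. sw s x (\<lambda>p q. f p q z)) = sw s a (\<lambda>x y. sw s y (\<lambda>p q. f x p q))"
proof -
  define F where "F = (\<lambda>l. f (l ! 0) (l ! 1) (l ! 2))"
  have F: "F [x, y, z] = f x y z" for x y z by (simp add: F_def)
  let ?u = "sw fscale a (\<lambda>x y. sw fscale x (\<lambda>p q. basic [p, q, y]))"
  let ?v = "sw fscale a (\<lambda>x y. sw fscale y (\<lambda>p q. basic [x, p, q]))"
  have s: "vector_space s" using assms(1) by (rule lin_target)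
  interpret L: Vector_Spaces.linear fscale s "lin_ext s F" by (rule linear_lin_ext[OF s])
  have len: "us = [] \<and> (\<exists>b c. vs = [b, c]) \<or> (\<exists>a b. us = [a] \<and> vs = [b]) \<or> (\<exists>a b. us = [a, b] \<and> vs = [])"
    if "Suc (length us + length vs) = 3" for us vs :: "'a list"
    using that by (cases us; cases "tl us"; cases vs; cases "tl vs") auto
  have "lin_ext s F (?u - ?v) = 0"
  proof (rule lin_ext_tpow_null[OF s])
    show "?u - ?v \<in> tpow_null scale 3"
      using coassoc[of a] by (simp add: tpow_class_eq_iff)
    fix us vs :: "'a list" and v v' c assume "Suc (length us + length vs) = 3"
    then show "F (us @ (v + v') # vs) = F (us @ v # vs) + F (us @ v' # vs)"
      "F (us @ scale c v # vs) = s c (F (us @ v # vs))"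
      using len[of us vs] assms by (auto simp: F lin_add[OF assms(1)] lin_add[OF assms(2)] lin_add[OF assms(3)]
          lin_scale[OF assms(1)] lin_scale[OF assms(2)] lin_scale[OF assms(3)])
  qed
  then have "lin_ext s F ?u = lin_ext s F ?v" unfolding L.diff by simp
  then show ?thesis
    by (simp add: sweedler_image[OF L.linear_axioms] lin_ext_basic[OF s] F)
qed

end

context bialgebra
begin

lemma lin_mult_const_right: "lin s scale f \<Longrightarrow> lin s scale (\<lambda>x. f x * b)"
  by (simp add: Vector_Spaces.linear_iff distrib_right scale_mult_left)

lemma lin_mult_const_left: "lin s scale f \<Longrightarrow> lin s scale (\<lambda>x. b * f x)"
  by (simp add: Vector_Spaces.linear_iff distrib_left scale_mult_right)

lemma sw_mult:
  assumes "\<And>y. lin scale s (\<lambda>x. f x y)" "\<And>x. lin scale s (f x)"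
  shows "sw s (a * b) f = sw s a (\<lambda>x y. sw s b (\<lambda>p q. f (x * p) (y * q)))"
proof -
  have s: "vector_space s" using assms(2) by (rule lin_target)
  note L = linear_lin_ext[OF s, of "\<lambda>(x, y). f x y"]
  show ?thesis
    unfolding comult_mult sweedler_class[OF assms]
    by (simp add: sweedler_image[OF L] lin_ext_basic[OF s])
qed

lemma sw_one:
  assumes "\<And>y. lin scale s (\<lambda>x. f x y)" "\<And>x. lin scale s (f x)"
  shows "sw s 1 f = f 1 1"
  unfolding comult_one sweedler_class[OF assms] using lin_target[OF assms(2)] by (simp add: lin_ext_basic)

end


section \<open>The antipode\<close>

context hopf_algebra
begin

abbreviation "S \<equiv> antipode"

lemma lin_antipode_compose: "lin s scale g \<Longrightarrow> lin s scale (\<lambda>x. S (g x))"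
  by (rule lin_compose[OF antipode_linear])

lemma lin_counit_compose: "lin s scale g \<Longrightarrow> lin s (*) (\<lambda>x. counit (g x))"
  by (rule lin_compose[OF counit_linear])

text \<open>Together these rules prove that a Sweedler expression is linear in each of its variables, which is
  the side condition for applying coassociativity and multiplicativity of \<open>\<Delta>\<close>.\<close>

lemmas lin_intros = vector_space_axioms vector_space_field lin_id lin_mult_const_left
  lin_mult_const_right lin_scale_const lin_scale_vec lin_antipode_compose lin_counit_compose
  lin_sweedler_fun lin_sw_compose

text \<open>In Sweedler notation \<open>S(h\<^sub>1)\<^sub>1 h\<^sub>2 \<otimes> S(h\<^sub>1)\<^sub>2 = 1 \<otimes> S(h)\<close>. Inserting \<open>h\<^sub>3 S(h\<^sub>4)\<close> in the second factor turns the
  left-hand side into \<open>\<Delta>(S(h\<^sub>1) h\<^sub>2) (1 \<otimes> S(h\<^sub>3))\<close>, in which \<open>S(h\<^sub>1) h\<^sub>2\<close> collapses to the counit. The proof reads this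
  computation from right to left.\<close>

lemma antipode_comult_cancel:
  assumes F1: "\<And>y. lin scale s (\<lambda>x. F x y)" and F2: "\<And>x. lin scale s (F x)"
  shows "sw s h (\<lambda>p q. sw s (S p) (\<lambda>u v. F (u * q) v)) = F 1 (S h)"
proof -
  note s = lin_target[OF F2]
  note li = lin_intros s lin_compose[OF F1] lin_compose[OF F2]
  have ins: "s (counit r) (F 1 (S q)) =
      sw s r (\<lambda>p c. sw s (S p) (\<lambda>u v. sw s c (\<lambda>d e. F (u * d) ((v * e) * S q))))" for r q
  proof -
    let ?G = "\<lambda>x y. F x (y * S q)"
    have G1: "\<And>y. lin scale s (\<lambda>x. ?G x y)" and G2: "\<And>x. lin scale s (?G x)"
      by (intro li)+
    note G = lin_sw_arg[OF G1 G2]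
    have "sw s r (\<lambda>p c. sw s (S p) (\<lambda>u v. sw s c (\<lambda>d e. ?G (u * d) (v * e)))) =
        sw s r (\<lambda>p c. sw s (S p * c) ?G)"
      by (simp only: sw_mult[OF G1 G2])
    also have "\<dots> = sw s (sw scale r (\<lambda>p c. S p * c)) ?G"
      by (rule sweedler_image[OF G, symmetric])
    also have "\<dots> = s (counit r) (sw s 1 ?G)"
      unfolding antipode_left by (rule lin_scale[OF G])
    also have "\<dots> = s (counit r) (F 1 (S q))"
      by (subst sw_one[OF G1 G2]) simp
    finally show ?thesis by simp
  qed
  have "F 1 (S h) = sw s h (\<lambda>r q. s (counit r) (F 1 (S q)))"
    by (rule sw_counit_left[symmetric]) (intro li)
  also have "\<dots> = sw s h (\<lambda>r q. sw s r (\<lambda>p c.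
      sw s (S p) (\<lambda>u v. sw s c (\<lambda>d e. F (u * d) ((v * e) * S q)))))"
    by (simp only: ins)
  also have "\<dots> = sw s h (\<lambda>p r. sw s r (\<lambda>c q.
      sw s (S p) (\<lambda>u v. sw s c (\<lambda>d e. F (u * d) ((v * e) * S q)))))"
    by (rule sw_coassoc) (intro li)+
  also have "\<dots> = sw s h (\<lambda>p r. sw s (S p) (\<lambda>u v.
      sw s r (\<lambda>c q. sw s c (\<lambda>d e. F (u * d) ((v * e) * S q)))))"
    by (simp only: sweedler_swap[OF s, of "comult (S _)"])
  also have "\<dots> = sw s h (\<lambda>p r. sw s (S p) (\<lambda>u v. F (u * r) v))"
  proof -
    have "sw s r (\<lambda>c q. sw s c (\<lambda>d e. F (u * d) ((v * e) * S q))) = F (u * r) v" for r u v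
    proof -
      have "sw s r (\<lambda>c q. sw s c (\<lambda>d e. F (u * d) ((v * e) * S q))) =
          sw s r (\<lambda>d w. sw s w (\<lambda>e q. F (u * d) ((v * e) * S q)))"
        by (rule sw_coassoc) (intro li)+
      also have "\<dots> = sw s r (\<lambda>d w. F (u * d) (v * sw scale w (\<lambda>e q. e * S q)))"
      proof -
        have "F (u * d) (v * sw scale w (\<lambda>e q. e * S q)) =
            sw s w (\<lambda>e q. F (u * d) (v * (e * S q)))" for d w
          by (rule sweedler_image) (intro li)
        then show ?thesis by (simp only: mult.assoc)
      qed
      also have "\<dots> = sw s r (\<lambda>d w. s (counit w) (F (u * d) v))"
        by (simp add: antipode_right scale_mult_right lin_scale[OF F2])
      also have "\<dots> = F (u * r) v"
        by (rule sw_counit_right) (intro li)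
      finally show ?thesis .
    qed
    then show ?thesis by simp
  qed
  finally show ?thesis by simp
qed

text \<open>Multiply the first factor of \<open>S(h\<^sub>1)\<^sub>1 h\<^sub>2 \<otimes> S(h\<^sub>1)\<^sub>2 = 1 \<otimes> S(h)\<close> on the right by the antipode of one more
  Sweedler component of \<open>h\<close>: the left-hand side becomes \<open>\<Delta>(S(h))\<close>.\<close>

lemma comult_antipode:
  assumes F1: "\<And>y. lin scale s (\<lambda>x. F x y)" and F2: "\<And>x. lin scale s (F x)"
  shows "sw s (S h) F = sw s h (\<lambda>p q. F (S q) (S p))"
proof -
  note s = lin_target[OF F2]
  note li = lin_intros s lin_compose[OF F1] lin_compose[OF F2]
  have ins: "s (counit q) (sw s (S p) F) = sw s q (\<lambda>c d. sw s (S p) (\<lambda>u v. F (u * (c * S d)) v))" for p q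
  proof -
    have "sw s q (\<lambda>c d. sw s (S p) (\<lambda>u v. F (u * (c * S d)) v)) =
        sw s (S p) (\<lambda>u v. sw s q (\<lambda>c d. F (u * (c * S d)) v))"
      by (rule sweedler_swap[OF s])
    also have "\<dots> = sw s (S p) (\<lambda>u v. F (u * sw scale q (\<lambda>c d. c * S d)) v)"
    proof -
      have "F (u * sw scale q (\<lambda>c d. c * S d)) v = sw s q (\<lambda>c d. F (u * (c * S d)) v)" for u v
        by (rule sweedler_image) (intro li)
      then show ?thesis by simp
    qed
    also have "\<dots> = sw s (S p) (\<lambda>u v. s (counit q) (F u v))"
      by (simp add: antipode_right scale_mult_right lin_scale[OF F1])
    also have "\<dots> = s (counit q) (sw s (S p) F)"
      by (rule sweedler_image[symmetric]) (intro lin_scale_const lin_ident s)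
    finally show ?thesis by simp
  qed
  have "sw s (S h) F = sw s h (\<lambda>p q. s (counit q) (sw s (S p) F))"
    by (rule sw_counit_right[symmetric]) (intro li F1 F2)
  also have "\<dots> = sw s h (\<lambda>p q. sw s q (\<lambda>c d. sw s (S p) (\<lambda>u v. F (u * (c * S d)) v)))"
    by (simp only: ins)
  also have "\<dots> = sw s h (\<lambda>r d. sw s r (\<lambda>p c. sw s (S p) (\<lambda>u v. F (u * (c * S d)) v)))"
    by (rule sw_coassoc[symmetric]) (intro li)+
  also have "\<dots> = sw s h (\<lambda>r d. sw s r (\<lambda>p c. sw s (S p) (\<lambda>u v. F ((u * c) * S d) v)))"
    by (simp only: mult.assoc)
  also have "\<dots> = sw s h (\<lambda>r d. F (1 * S d) (S r))"
  proof -
    have "sw s r (\<lambda>p c. sw s (S p) (\<lambda>u v. F ((u * c) * S d) v)) = F (1 * S d) (S r)" for r d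
      by (rule antipode_comult_cancel[of s "\<lambda>u v. F (u * S d) v"]) (intro li)+
    then show ?thesis by simp
  qed
  finally show ?thesis by simp
qed

lemma counit_antipode: "counit (S a) = counit a"
proof -
  have "counit (S a) = sw (*) a (\<lambda>x y. counit x * counit (S y))"
    by (rule sw_counit_left[symmetric]) (intro lin_intros)
  also have "\<dots> = counit (sw scale a (\<lambda>x y. x * S y))"
    by (simp add: sweedler_image[OF counit_linear] counit_mult)
  also have "\<dots> = counit a"
    by (simp add: antipode_right lin_scale[OF counit_linear] counit_one)
  finally show ?thesis .
qed

text \<open>This is the identity \<open>u\<^sub>1 S(u\<^sub>2) = \<epsilon>(u)\<close> for \<open>u = S(k)\<close>.\<close>

lemma antipode_antipode_cancel: "sw scale k (\<lambda>p q. S q * S (S p)) = scale (counit k) 1"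
proof -
  have "sw scale k (\<lambda>p q. S q * S (S p)) = sw scale (S k) (\<lambda>u v. u * S v)"
    by (rule comult_antipode[symmetric]) (intro lin_intros)+
  then show ?thesis by (simp add: antipode_right counit_antipode)
qed

section \<open>Functionals acting on the algebra\<close>

text \<open>The linear functionals on a coalgebra form an algebra under convolution, with unit \<open>\<epsilon>\<close>.\<close>

definition conv :: "('a \<Rightarrow> 'k) \<Rightarrow> ('a \<Rightarrow> 'k) \<Rightarrow> 'a \<Rightarrow> 'k" where
  "conv f g a = sw (*) a (\<lambda>x y. f x * g y)"

text \<open>The left action of the convolution algebra on \<open>A\<close>, usually written \<open>g \<rightharpoonup> a = a\<^sub>1 g(a\<^sub>2)\<close>. An element \<open>a\<close>
  is coinvariant for a quotient of \<open>A\<close> when \<open>g \<rightharpoonup> a = g(1) a\<close> for all functionals \<open>g\<close> on the quotient.\<close>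

definition hit :: "('a \<Rightarrow> 'k) \<Rightarrow> 'a \<Rightarrow> 'a" where
  "hit g a = sw scale a (\<lambda>x y. scale (g y) x)"

lemma lin_hit:
  assumes "lin scale (*) g" shows "lin scale scale (hit g)"
  unfolding hit_def by (intro lin_intros lin_compose[OF assms])

lemma lin_conv:
  assumes "lin scale (*) f" "lin scale (*) g" shows "lin scale (*) (conv f g)"
  unfolding conv_def by (intro lin_intros lin_compose[OF assms(1)] lin_compose[OF assms(2)])

lemma apply_hit: "lin scale (*) f \<Longrightarrow> f (hit g a) = conv f g a"
  unfolding hit_def conv_def by (simp add: sweedler_image lin_scale mult.commute)

lemma conv_assoc:
  assumes f: "lin scale (*) f" and g: "lin scale (*) g" and h: "lin scale (*) h"
  shows "conv (conv f g) h a = conv f (conv g h) a"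
  unfolding conv_def sweedler_mult_left sweedler_mult_right mult.assoc
  by (rule sw_coassoc) (intro lin_intros lin_compose[OF f] lin_compose[OF g] lin_compose[OF h])+

lemma conv_counit_left: "lin scale (*) f \<Longrightarrow> conv (\<lambda>x. c * counit x) f a = c * f a"
  unfolding conv_def mult.assoc sweedler_mult_left[symmetric] by (simp add: sw_counit_left)

lemma conv_sum_left: "conv (\<lambda>x. \<Sum>i\<in>X. u i * f i x) g a = (\<Sum>i\<in>X. u i * conv (f i) g a)"
  unfolding conv_def sweedler_mult_left
  by (simp add: sum_distrib_right sweedler_fun_sum[OF vector_space_field] mult.assoc)

lemma conv_sum_right: "conv f (\<lambda>x. \<Sum>i\<in>X. u i * g i x) a = (\<Sum>i\<in>X. u i * conv f (g i) a)"
  unfolding conv_def sweedler_mult_left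
  by (simp add: sum_distrib_left sweedler_fun_sum[OF vector_space_field] mult.left_commute)

text \<open>Expanding \<open>\<Delta>(a S(h\<^sub>1))\<close>, the left-hand side is \<open>a\<^sub>1 S(h\<^sub>1)\<^sub>1 h\<^sub>2\<close> weighted by \<open>g(a\<^sub>2 S(h\<^sub>1)\<^sub>2)\<close>, so that
  \<open>antipode_comult_cancel\<close> applies. Read from right to left, it rewrites \<open>a\<^sub>1 g(a\<^sub>2 S(h))\<close> as a
  combination of elements \<open>(g \<rightharpoonup> b) q\<close>; for integrals \<open>g\<close> the first factors are coinvariants.\<close>

lemma hit_antipode:
  assumes g: "lin scale (*) g"
  shows "sw scale h (\<lambda>p q. hit g (a * S p) * q) = hit (\<lambda>y. g (y * S h)) a"
proof -
  note li = lin_intros lin_compose[OF g]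
  let ?F = "\<lambda>x y u v. scale (g (y * v)) (x * u)"
  have "hit g (a * S p) * q = sw scale a (\<lambda>x y. sw scale (S p) (\<lambda>u v. ?F x y (u * q) v))" for p q
  proof -
    have "hit g (a * S p) = sw scale a (\<lambda>x y. sw scale (S p) (\<lambda>u v. ?F x y u v))"
      unfolding hit_def by (rule sw_mult) (intro li)+
    moreover have "sw scale b G * q = sw scale b (\<lambda>x y. G x y * q)" for b and G :: "'a \<Rightarrow> 'a \<Rightarrow> 'a"
      by (rule sweedler_image) (intro li)
    ultimately show ?thesis
      by (simp add: scale_mult_left mult.assoc)
  qed
  then have "sw scale h (\<lambda>p q. hit g (a * S p) * q) =
      sw scale h (\<lambda>p q. sw scale a (\<lambda>x y. sw scale (S p) (\<lambda>u v. ?F x y (u * q) v)))"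
    by simp
  also have "\<dots> = sw scale a (\<lambda>x y. sw scale h (\<lambda>p q. sw scale (S p) (\<lambda>u v. ?F x y (u * q) v)))"
    by (rule sweedler_swap) (rule vector_space_axioms)
  also have "\<dots> = sw scale a (\<lambda>x y. ?F x y 1 (S h))"
  proof -
    have "sw scale h (\<lambda>p q. sw scale (S p) (\<lambda>u v. ?F x y (u * q) v)) = ?F x y 1 (S h)" for x y
      by (rule antipode_comult_cancel) (intro li)+
    then show ?thesis by simp
  qed
  finally show ?thesis by (simp add: hit_def)
qed

lemma conv_translate_antipode:
  assumes f: "lin scale (*) f" and g: "lin scale (*) g"
  shows "conv f (\<lambda>y. g (y * S h)) a = sw (*) h (\<lambda>p q. conv (\<lambda>y. f (y * q)) g (a * S p))"
proof -
  have "f (hit g b * q) = conv (\<lambda>y. f (y * q)) g b" for b q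
    by (rule apply_hit) (intro lin_intros lin_compose[OF f])
  then show ?thesis
    using f by (simp add: apply_hit[symmetric] hit_antipode[OF g, symmetric] sweedler_image)
qed

end


section \<open>Finite-dimensional linear algebra\<close>

definition fun_scale :: "('k \<Rightarrow> 'b \<Rightarrow> 'b) \<Rightarrow> 'k \<Rightarrow> ('x \<Rightarrow> 'b) \<Rightarrow> 'x \<Rightarrow> 'b" where
  "fun_scale s c f = (\<lambda>x. s c (f x))"

lemma vector_space_fun_scale:
  assumes "vector_space s" shows "vector_space (fun_scale s)"
proof -
  interpret vector_space s by fact
  show ?thesis
    by unfold_locales (auto simp: fun_scale_def fun_eq_iff scale_right_distrib scale_left_distrib)
qed

lemma sum_fun_apply: "(\<Sum>i\<in>X. f i) x = (\<Sum>i\<in>X. f i x)"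
  by (induction X rule: infinite_finite_induct) auto

text \<open>The image of a basis of \<open>W\<close> is independent and has as many elements as the basis, so it spans \<open>W\<close>. The
  lemma is about a subspace because the ambient type will be a space of all functions.\<close>

lemma injective_endo_onto:
  assumes T: "lin s s T" and W: "module.subspace s W" "W \<subseteq> module.span s E" "finite E"
    and TW: "T ` W \<subseteq> W" and inj: "inj_on T W"
  shows "W \<subseteq> T ` W"
proof -
  interpret L: Vector_Spaces.linear s s T by fact
  obtain B where B: "B \<subseteq> W" "L.vs1.independent B" "W \<subseteq> L.vs1.span B"
    using L.vs1.maximal_independent_subset[of W] by auto
  have span: "L.vs1.span B = W"
    using B W(1) L.vs1.span_minimal[of B W] by blast
  have fin: "finite B"
    using L.vs1.independent_span_bound[OF W(3) B(2)] B(1) W(2) by blast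
  have ind: "L.vs1.independent (T ` B)"
    using L.independent_injective_image[OF B(2)] inj span by simp
  have card: "card (T ` B) = card B"
    using inj B(1) by (intro card_image) (rule inj_on_subset)
  have "B \<subseteq> L.vs1.span (T ` B)"
  proof
    fix x assume x: "x \<in> B"
    show "x \<in> L.vs1.span (T ` B)"
    proof (rule ccontr)
      assume n: "x \<notin> L.vs1.span (T ` B)"
      then have "L.vs1.independent (insert x (T ` B))"
        using ind by (simp add: L.vs1.independent_insert)
      moreover have "insert x (T ` B) \<subseteq> L.vs1.span B"
        using x B(1) TW span by auto
      ultimately have "card (insert x (T ` B)) \<le> card B"
        using L.vs1.independent_span_bound[OF fin] by blast
      moreover have "x \<notin> T ` B" using n L.vs1.span_base by blast
      ultimately show False using card fin by simp
    qed
  qed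
  then have "W \<subseteq> L.vs1.span (T ` B)"
    using L.vs1.span_minimal[of B "L.vs1.span (T ` B)"] span by auto
  also have "\<dots> = T ` W" using L.span_image[of B] span by simp
  finally show ?thesis .
qed

text \<open>Extend a basis of \<open>I\<close> to a basis of the whole space: the new basis vectors \<open>C\<close> represent a basis of the
  quotient by \<open>I\<close>, and their coordinate functions are the dual basis.\<close>

lemma coordinates_modulo_subspace:
  assumes "finite_dimensional_vector_space s Bas" and I: "module.subspace s I"
  shows "\<exists>C e. finite C \<and> (\<forall>c\<in>C. lin s (*) (e c)) \<and> (\<forall>c\<in>C. \<forall>x\<in>I. e c x = 0) \<and>
    (\<forall>x. x - (\<Sum>c\<in>C. s (e c x) c) \<in> I)"
proof -
  interpret finite_dimensional_vector_space s Bas by fact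
  obtain B where B: "B \<subseteq> I" "independent B" "I \<subseteq> span B"
    using maximal_independent_subset[of I] by auto
  obtain D where D: "B \<subseteq> D" "independent D" "UNIV \<subseteq> span D"
    using maximal_independent_subset_extend[of B UNIV] B(2) by auto
  have fin: "finite D" using D(2) by (rule finiteI_independent)
  have span: "x \<in> span D" for x using D(3) by auto
  let ?e = "\<lambda>c x. representation D x c"
  have "lin s (*) (?e c)" for c
    by (intro linI vector_space_axioms vector_space_field)
       (simp_all add: representation_add[OF D(2) span span] representation_scale[OF D(2) span])
  moreover have "?e c x = 0" if "c \<in> D - B" "x \<in> I" for c x
  proof -
    have x: "x \<in> span B" using that(2) B(3) by blast
    have "representation D x = representation B x"
      by (rule representation_extend[OF D(2) x D(1)])
    then show ?thesis using that(1) representation_ne_zero[of B x c] by auto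
  qed
  moreover have "x - (\<Sum>c\<in>D - B. s (?e c x) c) \<in> I" for x
  proof -
    have "x = (\<Sum>c\<in>D. s (?e c x) c)"
      using sum_representation_eq[OF D(2) span fin subset_refl] by simp
    also have "\<dots> = (\<Sum>c\<in>B. s (?e c x) c) + (\<Sum>c\<in>D - B. s (?e c x) c)"
      using sum.subset_diff[OF D(1) fin] by (simp add: add.commute)
    finally have "x - (\<Sum>c\<in>D - B. s (?e c x) c) = (\<Sum>c\<in>B. s (?e c x) c)"
      by (simp add: algebra_simps)
    then show ?thesis using B(1) I by (auto intro!: subspace_sum subspace_scale)
  qed
  ultimately show ?thesis using fin by (intro exI[of _ "D - B"] exI[of _ ?e]) simp
qed

section \<open>Bi-ideals of a finite-dimensional Hopf algebra\<close>

text \<open>A two-sided ideal in the kernel of \<open>\<epsilon>\<close> that is also a coideal. The coideal condition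
  \<open>\<Delta>(I) \<subseteq> I \<otimes> A + A \<otimes> I\<close> is stated dually: the functionals vanishing on \<open>I\<close> are closed under
  convolution.\<close>

locale bi_ideal = hopf_algebra scale comult counit antipode
  for scale :: "'k::field \<Rightarrow> 'a::ring_1 \<Rightarrow> 'a"
    and comult :: "'a \<Rightarrow> ('a \<times> 'a \<Rightarrow>\<^sub>0 'k) set"
    and counit :: "'a \<Rightarrow> 'k"
    and antipode :: "'a \<Rightarrow> 'a" +
  fixes I :: "'a set" and Bas :: "'a set"
  assumes fin_dim: "finite_dimensional_vector_space scale Bas"
    and subspace_I: "subspace I"
    and ideal_left: "x \<in> I \<Longrightarrow> b * x \<in> I"
    and ideal_right: "x \<in> I \<Longrightarrow> x * b \<in> I"
    and counit_I: "x \<in> I \<Longrightarrow> counit x = 0"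
    and coideal: "lin scale (*) f \<Longrightarrow> lin scale (*) g \<Longrightarrow> (\<And>x. x \<in> I \<Longrightarrow> f x = 0) \<Longrightarrow>
      (\<And>x. x \<in> I \<Longrightarrow> g x = 0) \<Longrightarrow> x \<in> I \<Longrightarrow> sweedler (*) (comult x) (\<lambda>p q. f p * g q) = 0"

text \<open>\<open>C\<close> and \<open>e\<close> play the role of a basis of \<open>A / I\<close> and its dual basis. The quotient itself is never formed:
  functionals on it are functionals on \<open>A\<close> that vanish on \<open>I\<close>, and identities in it are tested by them.\<close>

locale bi_ideal_coords = bi_ideal scale comult counit antipode I Bas
  for scale :: "'k::field \<Rightarrow> 'a::ring_1 \<Rightarrow> 'a"
    and comult :: "'a \<Rightarrow> ('a \<times> 'a \<Rightarrow>\<^sub>0 'k) set"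
    and counit :: "'a \<Rightarrow> 'k"
    and antipode :: "'a \<Rightarrow> 'a"
    and I :: "'a set" and Bas :: "'a set" +
  fixes C :: "'a set" and e :: "'a \<Rightarrow> 'a \<Rightarrow> 'k"
  assumes lin_e: "c \<in> C \<Longrightarrow> lin scale (*) (e c)"
    and e_I: "c \<in> C \<Longrightarrow> x \<in> I \<Longrightarrow> e c x = 0"
    and residue_I: "x - (\<Sum>c\<in>C. scale (e c x) c) \<in> I"

context bi_ideal
begin

text \<open>\<open>perp\<close> describes the dual of the quotient \<open>A / I\<close> as a space of functionals on \<open>A\<close>.\<close>

definition perp :: "('a \<Rightarrow> 'k) \<Rightarrow> bool" where
  "perp f \<longleftrightarrow> lin scale (*) f \<and> (\<forall>x\<in>I. f x = 0)"

lemma perp_lin: "perp f \<Longrightarrow> lin scale (*) f"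
  by (simp add: perp_def)

lemma perp_zero: "perp f \<Longrightarrow> x \<in> I \<Longrightarrow> f x = 0"
  by (simp add: perp_def)

lemma perp_counit: "perp counit"
  by (simp add: perp_def counit_linear counit_I)

lemma perp_conv: "perp f \<Longrightarrow> perp g \<Longrightarrow> perp (conv f g)"
  unfolding perp_def by (auto intro!: lin_conv simp: conv_def coideal)

lemma perp_compose:
  "perp f \<Longrightarrow> lin scale scale \<theta> \<Longrightarrow> (\<And>x. x \<in> I \<Longrightarrow> \<theta> x \<in> I) \<Longrightarrow> perp (\<lambda>x. f (\<theta> x))"
  unfolding perp_def by (auto intro!: lin_compose[of scale "(*)" f scale \<theta>])

lemma perp_translate_right: "perp f \<Longrightarrow> perp (\<lambda>x. f (x * b))"
  by (rule perp_compose) (auto intro!: lin_intros ideal_right)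

lemma perp_translate_left: "perp f \<Longrightarrow> perp (\<lambda>x. f (b * x))"
  by (rule perp_compose) (auto intro!: lin_intros ideal_left)

lemma perp_mult_right: "perp f \<Longrightarrow> perp (\<lambda>x. f x * c)"
  unfolding perp_def by (auto intro!: lin_mult_right)

lemma perp_sum: "(\<And>i. i \<in> X \<Longrightarrow> perp (\<lambda>x. f x i)) \<Longrightarrow> perp (\<lambda>x. \<Sum>i\<in>X. f x i)"
  unfolding perp_def
  by (auto intro!: lin_sumI vector_space_axioms vector_space_field sum.neutral)

lemma perp_sweedler: 
  assumes "\<And>x y. perp (\<lambda>z. f z x y)"
  shows "perp (\<lambda>z. sweedler (*) D (f z))"
proof -
  have "sweedler (*) D (f z) = 0" if "z \<in> I" for z
    using that assms by (simp add: perp_def sweedler_def lin_ext_def case_prod_unfold)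
  moreover have "lin scale (*) (\<lambda>z. sweedler (*) D (f z))"
    using assms by (intro lin_intros) (simp_all add: perp_def)
  ultimately show ?thesis by (simp add: perp_def)
qed

end

context bi_ideal_coords
begin

lemma perp_e: "c \<in> C \<Longrightarrow> perp (e c)"
  by (simp add: perp_def lin_e e_I)

lemma perp_expand:
  assumes "perp f" shows "f x = (\<Sum>c\<in>C. f c * e c x)"
proof -
  have "f (x - (\<Sum>c\<in>C. scale (e c x) c)) = 0"
    using assms residue_I by (rule perp_zero)
  then show ?thesis
    using perp_lin[OF assms] by (simp add: lin_diff lin_sum lin_scale mult.commute)
qed

lemma sw_perp_expand:
  assumes "\<And>q. perp (\<lambda>p. \<beta> p q)" "\<And>p. perp (\<beta> p)"
  shows "sw (*) a \<beta> = (\<Sum>c\<in>C. \<Sum>d\<in>C. \<beta> c d * conv (e c) (e d) a)"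
proof -
  have "\<beta> p q = (\<Sum>c\<in>C. \<Sum>d\<in>C. \<beta> c d * (e c p * e d q))" for p q
  proof -
    have "\<beta> p q = (\<Sum>c\<in>C. \<beta> c q * e c p)" by (rule perp_expand[OF assms(1)])
    also have "\<dots> = (\<Sum>c\<in>C. (\<Sum>d\<in>C. \<beta> c d * e d q) * e c p)"
      by (simp only: perp_expand[OF assms(2), symmetric])
    finally show ?thesis by (simp add: sum_distrib_left mult_ac)
  qed
  then have "sw (*) a \<beta> = sw (*) a (\<lambda>p q. \<Sum>c\<in>C. \<Sum>d\<in>C. \<beta> c d * (e c p * e d q))"
    by (intro arg_cong[of _ _ "sw (*) a"] ext)
  also have "\<dots> = (\<Sum>c\<in>C. \<Sum>d\<in>C. sw (*) a (\<lambda>p q. \<beta> c d * (e c p * e d q)))"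
    by (simp only: sweedler_fun_sum[OF vector_space_field])
  finally show ?thesis
    by (simp only: conv_def sweedler_mult_left)
qed

lemma mem_I_if_perp:
  assumes "\<And>f. perp f \<Longrightarrow> f x = 0" shows "x \<in> I"
proof -
  have "e c x = 0" if "c \<in> C" for c using assms perp_e that by blast
  then have "(\<Sum>c\<in>C. scale (e c x) c) = 0" by simp
  then show ?thesis using residue_I[of x] by simp
qed

text \<open>Convolution is dual to comultiplication: in the quotient, \<open>\<Sum>\<^sub>k \<Delta>(k) \<otimes> e\<^sub>k = \<Sum>\<^sub>c\<^sub>,\<^sub>d c \<otimes> d \<otimes> (e\<^sub>c * e\<^sub>d)\<close>.
  The lemma applies a trilinear \<open>\<Phi>\<close> to both sides; the assumptions say that \<open>\<Phi>\<close> is well defined on the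
  quotient in both vector arguments.\<close>

lemma comult_dual_basis:
  assumes P1: "\<And>c q. c \<in> C \<Longrightarrow> perp (\<lambda>p. \<Phi> (e c) p q)"
    and P2: "\<And>c p. c \<in> C \<Longrightarrow> perp (\<lambda>q. \<Phi> (e c) p q)"
    and L: "\<And>u p q. \<Phi> (\<lambda>x. \<Sum>k\<in>C. u k * e k x) p q = (\<Sum>k\<in>C. u k * \<Phi> (e k) p q)"
  shows "(\<Sum>k\<in>C. sw (*) k (\<Phi> (e k))) = (\<Sum>c\<in>C. \<Sum>d\<in>C. \<Phi> (conv (e c) (e d)) c d)"
proof -
  have "(\<Sum>k\<in>C. sw (*) k (\<Phi> (e k))) =
      (\<Sum>k\<in>C. \<Sum>c\<in>C. \<Sum>d\<in>C. \<Phi> (e k) c d * conv (e c) (e d) k)"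
    by (intro sum.cong refl sw_perp_expand P1 P2)
  also have "\<dots> = (\<Sum>c\<in>C. \<Sum>d\<in>C. \<Sum>k\<in>C. conv (e c) (e d) k * \<Phi> (e k) c d)"
    by (subst sum.swap, rule sum.cong[OF refl], subst sum.swap) (simp add: mult.commute)
  also have "\<dots> = (\<Sum>c\<in>C. \<Sum>d\<in>C. \<Phi> (conv (e c) (e d)) c d)"
  proof (intro sum.cong refl)
    fix c d assume "c \<in> C" "d \<in> C"
    then have "(\<lambda>x. \<Sum>k\<in>C. conv (e c) (e d) k * e k x) = conv (e c) (e d)"
      by (intro ext perp_expand[symmetric] perp_conv perp_e)
    with L[of "conv (e c) (e d)" c d]
    show "(\<Sum>k\<in>C. conv (e c) (e d) k * \<Phi> (e k) c d) = \<Phi> (conv (e c) (e d)) c d"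
      by (simp only:)
  qed
  finally show ?thesis .
qed

text \<open>In the convolution algebra of endomorphisms of \<open>A\<close> the antipode is inverse to the identity map:
  \<open>S * (id * \<theta>) = \<theta>\<close>.\<close>

lemma conv_id_cancel:
  assumes "lin scale scale \<theta>"
  shows "sw scale x (\<lambda>p r. S p * sw scale r (\<lambda>q t. q * \<theta> t)) = \<theta> x"
proof -
  note li = lin_intros lin_compose[OF assms]
  have "S p * sw scale r (\<lambda>q t. q * \<theta> t) = sw scale r (\<lambda>q t. S p * (q * \<theta> t))" for p r
    by (rule sweedler_image) (intro li)
  then have "sw scale x (\<lambda>p r. S p * sw scale r (\<lambda>q t. q * \<theta> t)) =
      sw scale x (\<lambda>p r. sw scale r (\<lambda>q t. S p * (q * \<theta> t)))" by simp
  also have "\<dots> = sw scale x (\<lambda>r t. sw scale r (\<lambda>p q. S p * (q * \<theta> t)))"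
    by (rule sw_coassoc[symmetric]) (intro li)+
  also have "\<dots> = sw scale x (\<lambda>r t. sw scale r (\<lambda>p q. S p * q) * \<theta> t)"
  proof -
    have "sw scale r (\<lambda>p q. S p * q) * \<theta> t = sw scale r (\<lambda>p q. S p * q * \<theta> t)" for r t
      by (rule sweedler_image) (intro li)
    then show ?thesis by (simp add: mult.assoc)
  qed
  also have "\<dots> = sw scale x (\<lambda>r t. scale (counit r) (\<theta> t))"
    by (simp add: antipode_left scale_mult_left)
  also have "\<dots> = \<theta> x" using assms by (rule sw_counit_left)
  finally show ?thesis .
qed

text \<open>The endomorphisms
  \<open>\<theta>\<close> with \<open>\<theta>(I) \<subseteq> I\<close> form a finite-dimensional space that is stable under the injective map
  \<open>\<theta> \<mapsto> id * \<theta>\<close>. Hence this map is onto there, and the preimage of the convolution unit, which lies in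
  that space, is \<open>S\<close>.\<close>

lemma antipode_I:
  assumes "x \<in> I" shows "S x \<in> I"
proof -
  interpret fd: finite_dimensional_vector_space scale Bas by (rule fin_dim)
  define fs where "fs = (fun_scale scale :: 'k \<Rightarrow> ('a \<Rightarrow> 'a) \<Rightarrow> _)"
  interpret F: vector_space fs
    unfolding fs_def by (rule vector_space_fun_scale) (rule vector_space_axioms)
  \<comment> \<open>\<open>T\<close> is convolution with the identity from the left, and \<open>E\<close> consists of the matrix units, which span all endomorphisms.\<close>
  define T where "T = (\<lambda>\<theta> x. sw scale x (\<lambda>p q. p * \<theta> q))"
  define W where "W = {\<theta>. lin scale scale \<theta> \<and> (\<forall>x\<in>I. \<theta> x \<in> I)}"
  define E where "E = (\<lambda>(b, b') x. scale (representation Bas x b) b') ` (Bas \<times> Bas)"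
  have T_cancel: "\<theta> = \<theta>'" if "lin scale scale \<theta>" "lin scale scale \<theta>'" "T \<theta> = T \<theta>'" for \<theta> \<theta>'
  proof
    fix x
    have "sw scale r (\<lambda>q t. q * \<theta> t) = sw scale r (\<lambda>q t. q * \<theta>' t)" for r
      using that(3) by (auto simp: T_def fun_eq_iff)
    then show "\<theta> x = \<theta>' x"
      using conv_id_cancel[OF that(1), of x] conv_id_cancel[OF that(2), of x] by simp
  qed
  have linT: "lin fs fs T"
  proof (rule linI)
    fix \<theta> \<theta>' c
    show "T (\<theta> + \<theta>') = T \<theta> + T \<theta>'"
      by (auto simp: T_def fun_eq_iff distrib_left sweedler_fun_add[OF vector_space_axioms])
    have "scale c (sw scale x (\<lambda>p q. p * \<theta> q)) = sw scale x (\<lambda>p q. scale c (p * \<theta> q))" for x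
      by (rule sweedler_image) (intro lin_intros)
    then show "T (fs c \<theta>) = fs c (T \<theta>)"
      by (auto simp: T_def fs_def fun_scale_def fun_eq_iff scale_mult_right)
  qed (rule F.vector_space_axioms)+
  have subW: "F.subspace W"
    unfolding F.subspace_def
  proof (intro conjI ballI allI)
    show "0 \<in> W"
      using subspace_0[OF subspace_I] by (auto simp: W_def intro!: linI vector_space_axioms)
    fix \<theta> \<theta>' c assume \<theta>: "\<theta> \<in> W"
    have "lin scale scale (\<lambda>x. scale c (\<theta> x))" using \<theta> by (intro lin_scale_const) (simp add: W_def)
    then show "fs c \<theta> \<in> W"
      using \<theta> subspace_scale[OF subspace_I] by (auto simp: W_def fs_def fun_scale_def)
    assume \<theta>': "\<theta>' \<in> W"
    have l: "lin scale scale \<theta>" "lin scale scale \<theta>'" using \<theta> \<theta>' by (simp_all add: W_def)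
    have "lin scale scale (\<theta> + \<theta>')"
      by (intro linI vector_space_axioms)
         (simp_all add: lin_add[OF l(1)] lin_add[OF l(2)] lin_scale[OF l(1)] lin_scale[OF l(2)]
           scale_right_distrib add_ac)
    then show "\<theta> + \<theta>' \<in> W"
      using \<theta> \<theta>' subspace_add[OF subspace_I] by (auto simp: W_def)
  qed
  have finE: "finite E" by (simp add: E_def fd.finite_Basis)
  have E: "(\<lambda>x. scale (representation Bas x b) b') \<in> E" if "b \<in> Bas" "b' \<in> Bas" for b b'
    unfolding E_def using that by (intro rev_image_eqI[of "(b, b')"]) simp_all
  have WE: "W \<subseteq> F.span E"
  proof
    fix \<theta> assume "\<theta> \<in> W"
    then have \<theta>: "lin scale scale \<theta>" by (simp add: W_def)
    have ex: "x = (\<Sum>b\<in>Bas. scale (representation Bas x b) b)" for x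
      by (rule sum_representation_eq[symmetric])
         (auto simp: fd.independent_Basis fd.span_Basis fd.finite_Basis)
    have expand: "\<theta> x = (\<Sum>b\<in>Bas. \<Sum>b'\<in>Bas. scale (representation Bas (\<theta> b) b') (scale (representation Bas x b) b'))" for x
    proof -
      have "\<theta> x = (\<Sum>b\<in>Bas. scale (representation Bas x b) (\<theta> b))"
        by (subst ex[of x]) (simp add: lin_sum[OF \<theta>] lin_scale[OF \<theta>])
      also have "\<dots> = (\<Sum>b\<in>Bas. \<Sum>b'\<in>Bas. scale (representation Bas (\<theta> b) b') (scale (representation Bas x b) b'))"
      proof (rule sum.cong[OF refl])
        fix b
        show "scale (representation Bas x b) (\<theta> b) =
          (\<Sum>b'\<in>Bas. scale (representation Bas (\<theta> b) b') (scale (representation Bas x b) b'))"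
          by (subst ex[of "\<theta> b"]) (simp add: scale_sum_right mult.commute)
      qed
      finally show ?thesis .
    qed
    have "\<theta> = (\<Sum>b\<in>Bas. \<Sum>b'\<in>Bas. fs (representation Bas (\<theta> b) b') (\<lambda>x. scale (representation Bas x b) b'))"
      unfolding fs_def fun_scale_def fun_eq_iff sum_fun_apply by (intro allI expand)
    also have "\<dots> \<in> F.span E"
      by (rule F.span_sum, rule F.span_sum, rule F.span_scale, rule F.span_base, rule E)
    finally show "\<theta> \<in> F.span E" .
  qed
  have TW: "T ` W \<subseteq> W"
  proof
    fix \<theta>' assume "\<theta>' \<in> T ` W"
    then obtain \<theta> where \<theta>: "lin scale scale \<theta>" "\<And>x. x \<in> I \<Longrightarrow> \<theta> x \<in> I" and \<theta>': "\<theta>' = T \<theta>"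
      by (auto simp: W_def)
    have "T \<theta> x \<in> I" if x: "x \<in> I" for x
    proof (rule mem_I_if_perp)
      fix f assume f: "perp f"
      have "f (T \<theta> x) = sw (*) x (\<lambda>p q. f (p * \<theta> q))"
        unfolding T_def using perp_lin[OF f] by (rule sweedler_image)
      also have "\<dots> = (\<Sum>c\<in>C. \<Sum>d\<in>C. f (c * \<theta> d) * conv (e c) (e d) x)"
        using f \<theta> by (intro sw_perp_expand perp_translate_right perp_compose[OF perp_translate_left])
      also have "\<dots> = 0"
        using x by (intro sum.neutral ballI) (simp add: perp_zero[OF perp_conv[OF perp_e perp_e]])
      finally show "f (T \<theta> x) = 0" .
    qed
    moreover have "lin scale scale (T \<theta>)"
      unfolding T_def by (intro lin_intros lin_compose[OF \<theta>(1)])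
    ultimately show "\<theta>' \<in> W" by (simp add: W_def \<theta>')
  qed
  have "inj_on T W"
    by (rule inj_onI) (rule T_cancel, simp_all add: W_def)
  then have "W \<subseteq> T ` W"
    by (rule injective_endo_onto[OF linT subW WE finE TW])
  moreover have "(\<lambda>x. scale (counit x) 1) \<in> W"
  proof -
    have "lin scale scale (\<lambda>x. scale (counit x) 1)" by (intro lin_intros)
    then show ?thesis by (simp add: W_def counit_I subspace_0[OF subspace_I])
  qed
  ultimately have "(\<lambda>x. scale (counit x) 1) \<in> T ` W" by (rule subsetD)
  then obtain \<theta> where \<theta>: "(\<lambda>x. scale (counit x) 1) = T \<theta>" "\<theta> \<in> W" by (rule imageE)
  have "T S = (\<lambda>x. scale (counit x) 1)"
    by (simp add: T_def antipode_right)
  then have "T \<theta> = T S" using \<theta>(1) by simp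
  with \<theta>(2) have "\<theta> = S" by - (rule T_cancel, simp_all add: W_def antipode_linear)
  then show ?thesis using \<theta>(2) assms by (simp add: W_def)
qed

lemma perp_antipode: "perp f \<Longrightarrow> perp (\<lambda>x. f (S x))"
  by (rule perp_compose) (auto intro: antipode_linear antipode_I)

section \<open>Integrals\<close>

text \<open>The functionals vanishing on \<open>I\<close> form a right Hopf module over \<open>A / I\<close>: the action is
  \<open>(g \<cdot> h)(x) = g(x S(h))\<close> and the coaction sends \<open>g\<close> to \<open>\<Sum>\<^sub>c (e\<^sub>c * g) \<otimes> c\<close>. In any Hopf module
  \<open>m \<mapsto> m\<^sub>0 \<cdot> S(m\<^sub>1)\<close> is a projection onto the coinvariants, and \<open>m = (m\<^sub>0 \<cdot> S(m\<^sub>1)) \<cdot> m\<^sub>2\<close>. The functional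
  below is that projection applied to \<open>g\<close>; this is where the square of the antipode comes from.\<close>

definition trace_integral :: "('a \<Rightarrow> 'k) \<Rightarrow> 'a \<Rightarrow> 'k" where
  "trace_integral g x = (\<Sum>c\<in>C. conv (e c) g (x * S (S c)))"

lemma perp_trace_integral:
  assumes "perp g" shows "perp (trace_integral g)"
proof -
  have "perp (\<lambda>x. \<Sum>c\<in>C. conv (e c) g (x * S (S c)))"
    using assms by (intro perp_sum perp_translate_right[OF perp_conv] perp_e)
  then show ?thesis by (simp add: trace_integral_def[abs_def])
qed

text \<open>Since \<open>\<Sum>\<^sub>c f(x S(c)) e\<^sub>c(y) = f(x S(y))\<close>, the sum collapses to \<open>f(z\<^sub>1 S(z\<^sub>2))\<close>.\<close>

lemma sum_conv_dual_basis:
  assumes f: "perp f"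
  shows "(\<Sum>c\<in>C. conv (\<lambda>y. f (y * S c)) (e c) z) = f 1 * counit z"
proof -
  have "(\<Sum>c\<in>C. conv (\<lambda>y. f (y * S c)) (e c) z) =
      sw (*) z (\<lambda>x y. \<Sum>c\<in>C. f (x * S c) * e c y)"
    by (simp add: conv_def sweedler_fun_sum[OF vector_space_field])
  also have "\<dots> = sw (*) z (\<lambda>x y. f (x * S y))"
    by (simp only: perp_expand[OF perp_antipode[OF perp_translate_left[OF f]], symmetric])
  also have "\<dots> = f (sw scale z (\<lambda>x y. x * S y))"
    using perp_lin[OF f] by (rule sweedler_image[symmetric])
  also have "\<dots> = f 1 * counit z"
    by (simp add: antipode_right lin_scale[OF perp_lin[OF f]] mult.commute)
  finally show ?thesis .
qed

text \<open>The projected functionals are coinvariants, that is, left integrals of the dual of \<open>A / I\<close>. Moving the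
  translation by \<open>S(S(c))\<close> past \<open>f\<close> gives \<open>\<Sum>\<^sub>c (f\<^bsub>S(c\<^sub>1)\<^esub> * e\<^sub>c * g)(x S(S(c\<^sub>2)))\<close>, where
  \<open>f\<^bsub>u\<^esub>(y) = f(y u)\<close>. The dual basis identity turns \<open>c\<^sub>1, c\<^sub>2, e\<^sub>c\<close> into \<open>c, d, e\<^sub>c * e\<^sub>d\<close>, after which the factor
  \<open>\<Sum>\<^sub>c f\<^bsub>S(c)\<^esub> * e\<^sub>c\<close> is \<open>f(1) \<epsilon>\<close>.\<close>

lemma conv_trace_integral:
  assumes f: "perp f" and g: "perp g"
  shows "conv f (trace_integral g) x = f 1 * trace_integral g x"
proof -
  let ?\<Phi> = "\<lambda>h p q. conv (\<lambda>y. f (y * S p)) (conv h g) (x * S (S q))"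
  note pf = perp_translate_right[OF f] and pc = perp_conv[OF perp_e g]
  note lf = perp_lin[OF f] and lc = perp_lin[OF pc]
  have "conv f (\<lambda>z. conv (e c) g (z * S (S c))) x = sw (*) c (?\<Phi> (e c))" if c: "c \<in> C" for c
  proof -
    let ?F = "\<lambda>p q. conv (\<lambda>y. f (y * q)) (conv (e c) g) (x * S p)"
    have "conv f (\<lambda>z. conv (e c) g (z * S (S c))) x = sw (*) (S c) ?F"
      by (rule conv_translate_antipode[OF lf lc[OF c]])
    also have "\<dots> = sw (*) c (?\<Phi> (e c))"
    proof (rule comult_antipode)
      show "lin scale (*) (\<lambda>p. ?F p q)" for q
        by (intro lin_compose[OF perp_lin[OF perp_conv[OF pf pc[OF c]]]] lin_intros)
      show "lin scale (*) (?F p)" for p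
        unfolding conv_def[of _ "conv (e c) g"] by (intro lin_intros lin_compose[OF lf])
    qed
    finally show ?thesis .
  qed
  then have "conv f (trace_integral g) x = (\<Sum>c\<in>C. sw (*) c (?\<Phi> (e c)))"
    using conv_sum_right[of f "\<lambda>_. 1" "\<lambda>c z. conv (e c) g (z * S (S c))" C x]
    by (simp add: trace_integral_def[abs_def])
  also have "\<dots> = (\<Sum>c\<in>C. \<Sum>d\<in>C. ?\<Phi> (conv (e c) (e d)) c d)"
  proof (rule comult_dual_basis)
    show "perp (\<lambda>p. ?\<Phi> (e c) p q)" for c q
      unfolding conv_def[of _ "conv (e c) g"]
      by (intro perp_sweedler perp_mult_right perp_antipode[OF perp_translate_left] f)
    show "perp (\<lambda>q. ?\<Phi> (e c) p q)" if "c \<in> C" for c p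
      by (intro perp_antipode[OF perp_antipode[OF perp_translate_left]] perp_conv pf pc that)
    show "?\<Phi> (\<lambda>x. \<Sum>k\<in>C. u k * e k x) p q = (\<Sum>k\<in>C. u k * ?\<Phi> (e k) p q)" for u p q
    proof -
      have "conv (\<lambda>x. \<Sum>k\<in>C. u k * e k x) g = (\<lambda>z. \<Sum>k\<in>C. u k * conv (e k) g z)"
        by (rule ext) (rule conv_sum_left)
      then show ?thesis by (simp only: conv_sum_right)
    qed
  qed
  also have "\<dots> = (\<Sum>d\<in>C. \<Sum>c\<in>C. conv (conv (\<lambda>y. f (y * S c)) (e c)) (conv (e d) g) (x * S (S d)))"
  proof (subst sum.swap, intro sum.cong refl)
    fix c d assume cd: "c \<in> C" "d \<in> C"
    have "conv (conv (e c) (e d)) g = conv (e c) (conv (e d) g)"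
      using cd by (intro ext conv_assoc lin_e perp_lin[OF g])
    then show "?\<Phi> (conv (e c) (e d)) c d =
        conv (conv (\<lambda>y. f (y * S c)) (e c)) (conv (e d) g) (x * S (S d))"
      using cd by (simp add: conv_assoc perp_lin[OF pf] lin_e lc)
  qed
  also have "\<dots> = (\<Sum>d\<in>C. f 1 * conv (e d) g (x * S (S d)))"
  proof (rule sum.cong[OF refl])
    fix d assume d: "d \<in> C"
    have "(\<Sum>c\<in>C. conv (conv (\<lambda>y. f (y * S c)) (e c)) (conv (e d) g) z) =
        conv (\<lambda>z. f 1 * counit z) (conv (e d) g) z" for z
      using conv_sum_left[of "\<lambda>_. 1" "\<lambda>c. conv (\<lambda>y. f (y * S c)) (e c)" C "conv (e d) g" z]
      by (simp add: sum_conv_dual_basis[OF f])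
    then show "(\<Sum>c\<in>C. conv (conv (\<lambda>y. f (y * S c)) (e c)) (conv (e d) g) (x * S (S d))) =
        f 1 * conv (e d) g (x * S (S d))"
      by (simp add: conv_counit_left[OF lc[OF d]])
  qed
  finally show ?thesis by (simp add: trace_integral_def sum_distrib_left)
qed

text \<open>The decomposition \<open>m = (m\<^sub>0 \<cdot> S(m\<^sub>1)) \<cdot> m\<^sub>2\<close> for \<open>m = \<epsilon>\<close>, whose coaction is \<open>\<Sum>\<^sub>d e\<^sub>d \<otimes> d\<close>. It says that translates
  of integrals add up to the counit.\<close>

lemma sum_trace_integral:
  "(\<Sum>d\<in>C. trace_integral (e d) (x * S d)) = counit x"
proof -
  let ?\<Phi> = "\<lambda>h p q. h (x * (S q * S (S p)))"
  have "(\<Sum>d\<in>C. trace_integral (e d) (x * S d)) = (\<Sum>c\<in>C. \<Sum>d\<in>C. ?\<Phi> (conv (e c) (e d)) c d)"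
    by (subst sum.swap) (simp add: trace_integral_def mult.assoc)
  also have "\<dots> = (\<Sum>k\<in>C. sw (*) k (?\<Phi> (e k)))"
  proof (rule comult_dual_basis[symmetric])
    fix c q assume c: "c \<in> C"
    have "perp (\<lambda>p. e c ((x * S q) * S (S p)))"
      by (intro perp_antipode[OF perp_antipode[OF perp_translate_left]] perp_e c)
    then show "perp (\<lambda>p. ?\<Phi> (e c) p q)" by (simp only: mult.assoc)
    show "perp (\<lambda>q'. ?\<Phi> (e c) q q')"
      by (intro perp_antipode[OF perp_translate_right[OF perp_translate_left]] perp_e c)
  qed simp
  also have "\<dots> = (\<Sum>k\<in>C. e k x * counit k)"
  proof (rule sum.cong[OF refl])
    fix k assume k: "k \<in> C"
    have "lin scale (*) (\<lambda>z. e k (x * z))" by (intro lin_compose[OF lin_e[OF k]] lin_intros)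
    then have "sw (*) k (?\<Phi> (e k)) = e k (x * sw scale k (\<lambda>p q. S q * S (S p)))"
      by (rule sweedler_image[symmetric])
    then show "sw (*) k (?\<Phi> (e k)) = e k x * counit k"
      by (simp add: antipode_antipode_cancel scale_mult_right lin_scale[OF lin_e[OF k]] mult.commute)
  qed
  also have "\<dots> = counit x"
    using perp_expand[OF perp_counit, of x] by (simp add: mult.commute)
  finally show ?thesis .
qed

text \<open>Write \<open>a = a\<^sub>1 \<epsilon>(a\<^sub>2)\<close>, replace \<open>\<epsilon>\<close> by the sum of translated integrals and move the translations out with
  \<open>hit_antipode\<close>. Every first factor on the right-hand side is a coinvariant, because it is produced by
  an integral.\<close>

lemma trace_decomposition:
  "a = (\<Sum>d\<in>C. sw scale d (\<lambda>p q. hit (trace_integral (e d)) (a * S p) * q))"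
proof -
  have "(\<Sum>d\<in>C. sw scale d (\<lambda>p q. hit (trace_integral (e d)) (a * S p) * q)) =
      (\<Sum>d\<in>C. hit (\<lambda>y. trace_integral (e d) (y * S d)) a)"
    by (intro sum.cong refl hit_antipode perp_lin perp_trace_integral perp_e)
  also have "\<dots> = sw scale a (\<lambda>x y. \<Sum>d\<in>C. scale (trace_integral (e d) (y * S d)) x)"
    by (simp only: hit_def sweedler_fun_sum[OF vector_space_axioms])
  also have "\<dots> = sw scale a (\<lambda>x y. scale (counit y) x)"
    by (simp only: scale_sum_left[symmetric] sum_trace_integral)
  also have "\<dots> = a" by (rule counit_right)
  finally show ?thesis by (rule sym)
qed

lemma hit_hit:
  assumes "lin scale (*) f" "lin scale (*) g"
  shows "hit f (hit g a) = hit (conv f g) a"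
proof -
  note li = lin_intros lin_compose[OF assms(1)] lin_compose[OF assms(2)]
  have "hit f (hit g a) = sw scale a (\<lambda>x z. sw scale x (\<lambda>p q. scale (f q * g z) p))"
  proof -
    have "hit f (hit g a) = sw scale a (\<lambda>x z. hit f (scale (g z) x))"
      unfolding hit_def[of g] by (rule sweedler_image) (rule lin_hit[OF assms(1)])
    moreover have "hit f (scale c x) = sw scale x (\<lambda>p q. scale (f q * c) p)" for c x
    proof -
      have "scale c (hit f x) = sw scale x (\<lambda>p q. scale c (scale (f q) p))"
        unfolding hit_def by (rule sweedler_image) (intro li)
      then show ?thesis
        by (simp add: lin_scale[OF lin_hit[OF assms(1)]] mult.commute)
    qed
    ultimately show ?thesis by simp
  qed
  also have "\<dots> = sw scale a (\<lambda>p r. sw scale r (\<lambda>q z. scale (f q * g z) p))"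
    by (rule sw_coassoc) (intro li)+
  also have "\<dots> = hit (conv f g) a"
  proof -
    have "scale (conv f g r) p = sw scale r (\<lambda>q z. scale (f q * g z) p)" for r p
      unfolding conv_def by (rule sweedler_image) (intro li lin_ident)
    then show ?thesis by (simp add: hit_def)
  qed
  finally show ?thesis .
qed

text \<open>In \<open>trace_decomposition\<close> the counit of the coinvariant \<open>\<lambda> \<rightharpoonup> a S(p)\<close> is \<open>\<lambda>(a S(p))\<close>, which vanishes for
  \<open>a \<in> I\<close> since \<open>I\<close> is a right ideal.\<close>

theorem bi_ideal_subset_coinvariants:
  "I \<subseteq> span {b * y | b y. counit b = 0 \<and> (\<forall>f. perp f \<longrightarrow> hit f b = scale (f 1) b)}"
proof
  fix a assume a: "a \<in> I"
  let ?X = "{b * y | b y. counit b = 0 \<and> (\<forall>f. perp f \<longrightarrow> hit f b = scale (f 1) b)}"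
  have "hit (trace_integral (e d)) (a * S p) * q \<in> ?X" if d: "d \<in> C" for d p q
  proof -
    let ?l = "trace_integral (e d)" and ?b = "hit (trace_integral (e d)) (a * S p)"
    have l: "perp ?l" using d by (intro perp_trace_integral perp_e)
    have "counit ?b = ?l (a * S p)"
      using conv_counit_left[OF perp_lin[OF l], of 1] by (simp add: apply_hit[OF counit_linear])
    also have "\<dots> = 0" using l ideal_right[OF a] by (rule perp_zero)
    finally have "counit ?b = 0" .
    moreover have "hit f ?b = scale (f 1) ?b" if f: "perp f" for f
    proof -
      have "hit f ?b = hit (conv f ?l) (a * S p)"
        by (rule hit_hit[OF perp_lin[OF f] perp_lin[OF l]])
      also have "\<dots> = sw scale (a * S p) (\<lambda>x y. scale (f 1) (scale (?l y) x))"
        by (simp add: hit_def conv_trace_integral[OF f perp_e[OF d]])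
      also have "\<dots> = scale (f 1) ?b"
        unfolding hit_def by (rule sweedler_image[symmetric]) (intro lin_intros)
      finally show ?thesis .
    qed
    ultimately show ?thesis by blast
  qed
  then have "(\<Sum>d\<in>C. sw scale d (\<lambda>p q. hit (trace_integral (e d)) (a * S p) * q)) \<in> span ?X"
    by (intro span_sum sweedler_mem vector_space_axioms subspace_span span_base)
  then show "a \<in> span ?X" by (simp only: trace_decomposition[symmetric])
qed

end


section \<open>Tensors over finite-dimensional spaces\<close>

text \<open>The map sending a vector to a formal generator is linear only modulo the relations of a tensor
  product; this extends its linearity to finite linear combinations.\<close>

lemma linear_modulo_sum:
  assumes "vector_space s" "module.subspace s N" "vector_space t"
    and add: "\<And>x y. h (x + y) - h x - h y \<in> N" and sc: "\<And>c x. h (t c x) - s c (h x) \<in> N"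
  shows "h (\<Sum>i\<in>X. t (c i) (v i)) - (\<Sum>i\<in>X. s (c i) (h (v i))) \<in> N"
proof -
  interpret s: vector_space s by fact
  interpret t: vector_space t by fact
  note N = s.subspace_add[OF assms(2)] s.subspace_0[OF assms(2)]
  \<comment> \<open>The instance with scalar \<open>0\<close>, since \<open>t 0 0 = 0\<close> and \<open>s 0 (h 0) = 0\<close>.\<close>
  have zero: "h 0 \<in> N" using sc[of 0 0] by simp
  show ?thesis
  proof (induction X rule: infinite_finite_induct)
    case (insert i X)
    let ?x = "t (c i) (v i)" and ?y = "\<Sum>i\<in>X. t (c i) (v i)" and ?z = "\<Sum>i\<in>X. s (c i) (h (v i))"
    have "(h (?x + ?y) - h ?x - h ?y) + ((h ?x - s (c i) (h (v i))) + (h ?y - ?z)) \<in> N"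
      using insert.IH add sc by (intro N)
    then show ?case using insert.hyps by (simp add: algebra_simps)
  qed (simp_all add: zero)
qed

lemma tpow_rels_null: "x \<in> tpow_rels s n \<Longrightarrow> x \<in> tpow_null s n"
  unfolding tpow_null_def
  by (rule module.span_base) (simp_all add: module_iff_vector_space vector_space_fscale)

lemma tensor_rels_null: "x \<in> tensor_rels s t \<Longrightarrow> x \<in> tensor_null s t"
  unfolding tensor_null_def
  by (rule module.span_base) (simp_all add: module_iff_vector_space vector_space_fscale)

lemma subspace_tpow_null: "module.subspace fscale (tpow_null s n)"
  unfolding tpow_null_def
  by (rule module.subspace_span) (simp add: module_iff_vector_space vector_space_fscale)

lemma subspace_tensor_null: "module.subspace fscale (tensor_null s t)"
  unfolding tensor_null_def
  by (rule module.subspace_span) (simp add: module_iff_vector_space vector_space_fscale)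

lemma rep_tpow_class:
  fixes s :: "'k::field \<Rightarrow> 'm::ab_group_add \<Rightarrow> 'm"
  shows "rep (tpow_class s n x) - x \<in> tpow_null s n"
proof -
  interpret F: vector_space "fscale :: 'k \<Rightarrow> ('m list \<Rightarrow>\<^sub>0 'k) \<Rightarrow> _" by (rule vector_space_fscale)
  have "x \<in> tpow_class s n x"
    by (simp add: tpow_class_def F.subspace_0[OF subspace_tpow_null])
  then have "rep (tpow_class s n x) \<in> tpow_class s n x" unfolding rep_def by (rule someI)
  then show ?thesis by (simp add: tpow_class_def)
qed

text \<open>The diagonal action is evaluated on an arbitrary representative of a tensor; all tuples that occur in
  it must have the right length.\<close>

definition homogeneous :: "nat \<Rightarrow> ('m list \<Rightarrow>\<^sub>0 'k::field) set" where
  "homogeneous n = {z. \<forall>l\<in>Poly_Mapping.keys z. length l = n}"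

lemma subspace_homogeneous:
  "module.subspace fscale (homogeneous n :: ('m list \<Rightarrow>\<^sub>0 'k::field) set)"
proof -
  interpret F: vector_space "fscale :: 'k \<Rightarrow> ('m list \<Rightarrow>\<^sub>0 'k) \<Rightarrow> _" by (rule vector_space_fscale)
  show ?thesis
    unfolding F.subspace_def homogeneous_def
    using Poly_Mapping.keys_add by (auto simp: in_keys_iff lookup_add)
qed

lemma homogeneous_basic: "length l = n \<Longrightarrow> basic l \<in> homogeneous n"
  by (simp add: homogeneous_def)

lemma tpow_null_homogeneous:
  fixes s :: "'k::field \<Rightarrow> 'm::ab_group_add \<Rightarrow> 'm"
  shows "tpow_null s n \<subseteq> homogeneous n"
proof -
  interpret F: vector_space "fscale :: 'k \<Rightarrow> ('m list \<Rightarrow>\<^sub>0 'k) \<Rightarrow> _" by (rule vector_space_fscale)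
  note sub = F.subspace_diff[OF subspace_homogeneous] F.subspace_scale[OF subspace_homogeneous]
  show ?thesis
    unfolding tpow_null_def
  proof (rule F.span_minimal[OF _ subspace_homogeneous])
    show "tpow_rels s n \<subseteq> homogeneous n"
      by (auto simp: tpow_rels_def intro!: sub homogeneous_basic)
  qed
qed

fun pairing :: "('m \<Rightarrow> 'k::field) list \<Rightarrow> 'm list \<Rightarrow> 'k" where
  "pairing [] [] = 1"
| "pairing (\<phi> # \<phi>s) (m # ms) = \<phi> m * pairing \<phi>s ms"
| "pairing _ _ = 0"

lemma pairing_add:
  assumes "\<forall>\<phi>\<in>set \<phi>s. lin s (*) \<phi>"
  shows "pairing \<phi>s (us @ (v + v') # vs) = pairing \<phi>s (us @ v # vs) + pairing \<phi>s (us @ v' # vs)"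
  using assms
proof (induction us arbitrary: \<phi>s)
  case Nil then show ?case by (cases \<phi>s) (auto simp: lin_add[of s "(*)"] algebra_simps)
next
  case (Cons u us) then show ?case by (cases \<phi>s) (auto simp: algebra_simps)
qed

lemma pairing_scale:
  assumes "\<forall>\<phi>\<in>set \<phi>s. lin s (*) \<phi>"
  shows "pairing \<phi>s (us @ s c v # vs) = c * pairing \<phi>s (us @ v # vs)"
  using assms
proof (induction us arbitrary: \<phi>s)
  case Nil then show ?case by (cases \<phi>s) (auto simp: lin_scale[of s "(*)"] algebra_simps)
next
  case (Cons u us) then show ?case by (cases \<phi>s) (auto simp: algebra_simps)
qed

lemma pairing_tpow_null:
  assumes "\<forall>\<phi>\<in>set \<phi>s. lin s (*) \<phi>" "z \<in> tpow_null s n"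
  shows "lin_ext (*) (pairing \<phi>s) z = 0"
  using assms(2)
  by (rule lin_ext_tpow_null[OF vector_space_field, rotated 2])
     (simp_all add: pairing_add[OF assms(1)] pairing_scale[OF assms(1)])

abbreviation cons_tensor :: "'m \<Rightarrow> ('m list \<Rightarrow>\<^sub>0 'k::field) \<Rightarrow> ('m list \<Rightarrow>\<^sub>0 'k)" where
  "cons_tensor u \<equiv> lin_ext fscale (\<lambda>l. basic (u # l))"

lemma lin_lookup: "lin fscale (*) (\<lambda>z. Poly_Mapping.lookup z t)"
  by (intro linI vector_space_fscale vector_space_field) (auto simp: lookup_add)

lemma lookup_lin_ext:
  "Poly_Mapping.lookup (lin_ext fscale f z) t = lin_ext (*) (\<lambda>l. Poly_Mapping.lookup (f l) t) z"
  by (rule lin_ext_image[OF lin_lookup vector_space_fscale])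

lemma lin_ext_zero_fun: "lin_ext (*) (\<lambda>_. 0) z = 0"
  by (simp add: lin_ext_def)

lemma lookup_cons_tensor:
  "Poly_Mapping.lookup (cons_tensor b z) t =
    (case t of [] \<Rightarrow> 0 | b' # t' \<Rightarrow> if b = b' then Poly_Mapping.lookup z t' else 0)"
proof (cases t)
  case Nil
  then show ?thesis by (simp add: lookup_lin_ext lookup_single lin_ext_zero_fun)
next
  case (Cons b' t')
  have "lin_ext (*) (\<lambda>l. Poly_Mapping.lookup (basic l) t') z = Poly_Mapping.lookup z t'"
    by (simp only: lookup_lin_ext[symmetric] lin_ext_basic_self)
  then show ?thesis
    using Cons by (auto simp: lookup_lin_ext lookup_single lin_ext_zero_fun when_def)
qed

text \<open>Putting \<open>u\<close> in front of every tuple maps relations for \<open>n\<close> factors to relations for \<open>n + 1\<close> factors,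
  which allows induction on the number of factors.\<close>

lemma cons_tensor_null:
  fixes s :: "'k::field \<Rightarrow> 'm::ab_group_add \<Rightarrow> 'm"
  assumes "z \<in> tpow_null s n"
  shows "cons_tensor u z \<in> tpow_null s (Suc n)"
proof -
  interpret F: vector_space "fscale :: 'k \<Rightarrow> ('m list \<Rightarrow>\<^sub>0 'k) \<Rightarrow> _" by (rule vector_space_fscale)
  interpret L: Vector_Spaces.linear fscale fscale "cons_tensor u :: ('m list \<Rightarrow>\<^sub>0 'k) \<Rightarrow> _"
    by (rule linear_lin_ext[OF vector_space_fscale])
  note simps = L.diff L.scale lin_ext_basic[OF vector_space_fscale]
  have "cons_tensor u ` tpow_rels s n \<subseteq> tpow_rels s (Suc n)"
  proof
    fix y assume "y \<in> cons_tensor u ` tpow_rels s n"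
    then obtain x where x: "x \<in> tpow_rels s n" and y: "y = cons_tensor u x" by blast
    from x consider
      us v v' vs where "x = basic (us @ (v + v') # vs) - basic (us @ v # vs) - basic (us @ v' # vs)"
        "Suc (length us + length vs) = n"
    | us c v vs where "x = basic (us @ s c v # vs) - fscale c (basic (us @ v # vs))"
        "Suc (length us + length vs) = n"
      unfolding tpow_rels_def by blast
    then show "y \<in> tpow_rels s (Suc n)"
    proof cases
      case 1
      then have "y = basic ((u # us) @ (v + v') # vs) - basic ((u # us) @ v # vs) - basic ((u # us) @ v' # vs)"
        by (simp add: y simps)
      moreover have "Suc (length (u # us) + length vs) = Suc n" using 1 by simp
      ultimately show ?thesis unfolding tpow_rels_def by blast
    next
      case 2
      then have "y = basic ((u # us) @ s c v # vs) - fscale c (basic ((u # us) @ v # vs))"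
        by (simp add: y simps)
      moreover have "Suc (length (u # us) + length vs) = Suc n" using 2 by simp
      ultimately show ?thesis unfolding tpow_rels_def by blast
    qed
  qed
  then have "F.span (cons_tensor u ` tpow_rels s n) \<subseteq> tpow_null s (Suc n)"
    unfolding tpow_null_def by (rule F.span_mono)
  then show ?thesis
    using assms L.span_image[of "tpow_rels s n"] by (auto simp: tpow_null_def)
qed

context finite_dimensional_vector_space
begin

abbreviation coord :: "'b \<Rightarrow> 'b \<Rightarrow> 'a" where
  "coord b v \<equiv> representation Basis v b"

lemma coord_expand: "(\<Sum>b\<in>Basis. scale (coord b v) b) = v"
  by (rule sum_representation_eq) (auto simp: independent_Basis span_Basis finite_Basis)

lemma lin_coord: "lin scale (*) (coord b)"
  by (intro linI vector_space_axioms vector_space_field)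
     (simp_all add: representation_add representation_scale independent_Basis span_Basis)

text \<open>The multilinear expansion of a pure tensor in pure tensors of basis vectors.\<close>

primrec expand :: "'b list \<Rightarrow> ('b list \<Rightarrow>\<^sub>0 'a)" where
  "expand [] = basic []"
| "expand (m # ms) = (\<Sum>b\<in>Basis. fscale (coord b m) (cons_tensor b (expand ms)))"

lemma lookup_expand:
  "Poly_Mapping.lookup (expand l) t = (if set t \<subseteq> Basis then pairing (map coord t) l else 0)"
proof (induction l arbitrary: t)
  case Nil
  then show ?case by (cases t) (auto simp: lookup_single when_def)
next
  case (Cons m ms)
  show ?case
  proof (cases t)
    case Nil
    then show ?thesis by (simp add: lin_sum[OF lin_lookup] lookup_cons_tensor)
  next
    fix b' t' assume t: "t = b' # t'"
    have "Poly_Mapping.lookup (expand (m # ms)) t =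
        (\<Sum>b\<in>Basis. if b = b' then coord b' m * Poly_Mapping.lookup (expand ms) t' else 0)"
      by (auto simp: t lin_sum[OF lin_lookup] lookup_cons_tensor intro!: sum.cong)
    also have "\<dots> = (if b' \<in> Basis then coord b' m * Poly_Mapping.lookup (expand ms) t' else 0)"
      using finite_Basis by (rule sum.delta)
    finally show ?thesis by (simp add: t Cons.IH)
  qed
qed

lemma expand_null: "basic l - expand l \<in> tpow_null scale (length l)"
proof (induction l)
  interpret F: vector_space "fscale :: 'a \<Rightarrow> ('b list \<Rightarrow>\<^sub>0 'a) \<Rightarrow> _" by (rule vector_space_fscale)
  case Nil
  then show ?case by (simp add: F.subspace_0[OF subspace_tpow_null])
next
  case (Cons m ms)
  interpret F: vector_space "fscale :: 'a \<Rightarrow> ('b list \<Rightarrow>\<^sub>0 'a) \<Rightarrow> _" by (rule vector_space_fscale)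
  interpret L: Vector_Spaces.linear fscale fscale "cons_tensor b :: ('b list \<Rightarrow>\<^sub>0 'a) \<Rightarrow> _" for b
    by (rule linear_lin_ext[OF vector_space_fscale])
  let ?N = "tpow_null scale (length (m # ms))"
  note N = F.subspace_add[OF subspace_tpow_null] F.subspace_sum[OF subspace_tpow_null]
    F.subspace_scale[OF subspace_tpow_null]
  have "basic ((\<Sum>b\<in>Basis. scale (coord b m) b) # ms) - (\<Sum>b\<in>Basis. fscale (coord b m) (basic (b # ms))) \<in> ?N"
  proof (rule linear_modulo_sum[OF vector_space_fscale subspace_tpow_null vector_space_axioms])
    fix x y c
    show "basic ((x + y) # ms) - basic (x # ms) - basic (y # ms) \<in> ?N"
      by (rule tpow_rels_null, unfold tpow_rels_def, rule UnI1) (force intro: exI[of _ "[]"])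
    show "basic (scale c x # ms) - fscale c (basic (x # ms)) \<in> ?N"
      by (rule tpow_rels_null, unfold tpow_rels_def, rule UnI2) (force intro: exI[of _ "[]"])
  qed
  moreover have "(\<Sum>b\<in>Basis. fscale (coord b m) (cons_tensor b (basic ms - expand ms))) \<in> ?N"
    using cons_tensor_null[OF Cons.IH] by (intro N) simp
  ultimately have "(basic (m # ms) - (\<Sum>b\<in>Basis. fscale (coord b m) (basic (b # ms)))) +
      (\<Sum>b\<in>Basis. fscale (coord b m) (cons_tensor b (basic ms - expand ms))) \<in> ?N"
    unfolding coord_expand by (rule N)
  then show ?case
    by (simp add: L.diff lin_ext_basic[OF vector_space_fscale] F.scale_right_diff_distrib sum_subtractf)
qed

text \<open>Over a finite-dimensional space, pure tensors of functionals separate the points of \<open>V\<^sup>\<otimes>\<^sup>n\<close>: the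
  coefficients of the expansion in basis tensors are such functionals.\<close>

lemma tpow_null_if_pairings_vanish:
  assumes z: "z \<in> homogeneous n"
    and "\<And>\<phi>s. \<forall>\<phi>\<in>set \<phi>s. lin scale (*) \<phi> \<Longrightarrow> lin_ext (*) (pairing \<phi>s) z = 0"
  shows "z \<in> tpow_null scale n"
proof -
  interpret F: vector_space "fscale :: 'a \<Rightarrow> ('b list \<Rightarrow>\<^sub>0 'a) \<Rightarrow> _" by (rule vector_space_fscale)
  have "lin_ext fscale expand z = 0"
  proof (rule poly_mapping_eqI)
    fix t
    have "lin_ext (*) (pairing (map coord t)) z = 0"
      using lin_coord by (intro assms(2)) auto
    then show "Poly_Mapping.lookup (lin_ext fscale expand z) t = Poly_Mapping.lookup 0 t"
      by (cases "set t \<subseteq> Basis") (simp_all add: lookup_lin_ext lookup_expand lin_ext_zero_fun)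
  qed
  moreover have "lin_ext fscale (\<lambda>l. (basic l - expand l) + expand l) z =
      lin_ext fscale (\<lambda>l. basic l - expand l) z + lin_ext fscale expand z"
    by (rule lin_ext_fun_add[OF vector_space_fscale])
  ultimately have "z = lin_ext fscale (\<lambda>l. basic l - expand l) z"
    by (simp add: lin_ext_basic_self)
  also have "\<dots> \<in> tpow_null scale n"
    using z expand_null
    by (intro lin_ext_mem[OF vector_space_fscale subspace_tpow_null]) (auto simp: homogeneous_def)
  finally show ?thesis .
qed

text \<open>Expanding the second factor in a basis, an element of \<open>V \<otimes> W\<close> is \<open>\<Sum>\<^sub>b v\<^sub>b \<otimes> b\<close>, where \<open>v\<^sub>b\<close> is its
  contraction with the coordinate function of \<open>b\<close>.\<close>

lemma tensor_null_if_contractions_vanish: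
  fixes sV :: "'a \<Rightarrow> 'v::ab_group_add \<Rightarrow> 'v"
  assumes sV: "vector_space sV"
    and "\<And>\<phi>. lin scale (*) \<phi> \<Longrightarrow> lin_ext sV (\<lambda>(x, m). sV (\<phi> m) x) z = 0"
  shows "z \<in> tensor_null sV scale"
proof -
  interpret V: vector_space sV by fact
  interpret F: vector_space "fscale :: 'a \<Rightarrow> ('v \<times> 'b \<Rightarrow>\<^sub>0 'a) \<Rightarrow> _" by (rule vector_space_fscale)
  let ?N = "tensor_null sV scale"
  note N = F.subspace_add[OF subspace_tensor_null] F.subspace_sum[OF subspace_tensor_null]
    F.subspace_diff[OF subspace_tensor_null]
  note rels = tensor_rels_null[unfolded tensor_rels_def]
  have addl: "basic (x + y, m) - basic (x, m) - basic (y, m) \<in> ?N"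
    and addr: "basic (x, m + m') - basic (x, m) - basic (x, m') \<in> ?N"
    and scl: "basic (sV c x, m) - fscale c (basic (x, m)) \<in> ?N"
    and scr: "basic (x, scale c m) - fscale c (basic (x, m)) \<in> ?N" for x y m m' c
    by (rule rels, blast)+
  let ?f = "\<lambda>b p. sV (coord b (snd p)) (fst p)"
  have one: "basic p - (\<Sum>b\<in>Basis. basic (?f b p, b)) \<in> ?N" for p
  proof -
    obtain x m where p: "p = (x, m)" by (cases p)
    have "basic (x, \<Sum>b\<in>Basis. scale (coord b m) b) - (\<Sum>b\<in>Basis. fscale (coord b m) (basic (x, b))) \<in> ?N"
      by (rule linear_modulo_sum[where h = "\<lambda>m. basic (x, m)", OF vector_space_fscale subspace_tensor_null
            vector_space_axioms addr scr])
    then have "basic (x, m) - (\<Sum>b\<in>Basis. fscale (coord b m) (basic (x, b))) \<in> ?N"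
      unfolding coord_expand .
    moreover have "(\<Sum>b\<in>Basis. basic (sV (coord b m) x, b) - fscale (coord b m) (basic (x, b))) \<in> ?N"
      by (rule N(2)) (rule scl)
    ultimately have "(basic (x, m) - (\<Sum>b\<in>Basis. fscale (coord b m) (basic (x, b)))) -
        (\<Sum>b\<in>Basis. basic (sV (coord b m) x, b) - fscale (coord b m) (basic (x, b))) \<in> ?N"
      by (rule N(3))
    then show ?thesis by (simp add: p sum_subtractf)
  qed
  have two: "(\<Sum>b\<in>Basis. lin_ext fscale (\<lambda>p. basic (?f b p, b)) z) \<in> ?N"
  proof (rule N)
    fix b
    have zero: "(\<Sum>p\<in>Poly_Mapping.keys z. sV (Poly_Mapping.lookup z p) (?f b p)) = 0"
      using assms(2)[OF lin_coord, of b] by (simp add: lin_ext_def case_prod_unfold)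
    have "basic (0, b) - lin_ext fscale (\<lambda>p. basic (?f b p, b)) z \<in> ?N"
      using linear_modulo_sum[where h = "\<lambda>x. basic (x, b)" and X = "Poly_Mapping.keys z"
          and c = "Poly_Mapping.lookup z" and v = "?f b",
          OF vector_space_fscale subspace_tensor_null sV addl scl]
      by (simp only: zero lin_ext_def)
    moreover have "basic (0, b) \<in> ?N" using scl[of 0 0 b] by simp
    ultimately have "basic (0, b) - (basic (0, b) - lin_ext fscale (\<lambda>p. basic (?f b p, b)) z) \<in> ?N"
      by (rule N(3)[rotated])
    then show "lin_ext fscale (\<lambda>p. basic (?f b p, b)) z \<in> ?N" by simp
  qed
  have "z = lin_ext fscale (\<lambda>p. (basic p - (\<Sum>b\<in>Basis. basic (?f b p, b))) + (\<Sum>b\<in>Basis. basic (?f b p, b))) z"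
    by (simp add: lin_ext_basic_self)
  also have "\<dots> = lin_ext fscale (\<lambda>p. basic p - (\<Sum>b\<in>Basis. basic (?f b p, b))) z +
      (\<Sum>b\<in>Basis. lin_ext fscale (\<lambda>p. basic (?f b p, b)) z)"
  proof -
    have "lin_ext fscale (\<lambda>p. \<Sum>b\<in>Basis. basic (?f b p, b)) z =
        (\<Sum>b\<in>Basis. lin_ext fscale (\<lambda>p. basic (?f b p, b)) z)"
      unfolding lin_ext_def F.scale_sum_right by (rule sum.swap)
    then show ?thesis by (simp only: lin_ext_fun_add[OF vector_space_fscale])
  qed
  also have "\<dots> \<in> ?N"
    using one two by (intro N(1) lin_ext_mem[OF vector_space_fscale subspace_tensor_null])
  finally show ?thesis .
qed

end

section \<open>Matrix coefficients\<close>

locale hopf_module = hopf_algebra scale comult counit antipode + Mod: left_module scale scaleM act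
  for scale :: "'k::field \<Rightarrow> 'a::ring_1 \<Rightarrow> 'a"
    and comult :: "'a \<Rightarrow> ('a \<times> 'a \<Rightarrow>\<^sub>0 'k) set"
    and counit :: "'a \<Rightarrow> 'k"
    and antipode :: "'a \<Rightarrow> 'a"
    and scaleM :: "'k \<Rightarrow> 'm::ab_group_add \<Rightarrow> 'm"
    and act :: "'a \<Rightarrow> 'm \<Rightarrow> 'm" +
  fixes BasA :: "'a set" and BasM :: "'m set"
  assumes fin_dim_A: "finite_dimensional_vector_space scale BasA"
    and fin_dim_M: "finite_dimensional_vector_space scaleM BasM"
begin

sublocale M: finite_dimensional_vector_space scaleM BasM
  by (rule fin_dim_M)

lemma conv_counit_right: "lin scale (*) f \<Longrightarrow> conv f counit a = f a"
  unfolding conv_def using sw_counit_right[of "(*)" f a] by (simp add: mult.commute)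

text \<open>The right action \<open>a \<leftharpoonup> f = f(a\<^sub>1) a\<^sub>2\<close>, the mirror image of \<open>hit\<close>.\<close>

definition lhit :: "('a \<Rightarrow> 'k) \<Rightarrow> 'a \<Rightarrow> 'a" where
  "lhit f a = sw scale a (\<lambda>x y. scale (f x) y)"

lemma apply_lhit: "lin scale (*) g \<Longrightarrow> g (lhit f a) = conv f g a"
  unfolding lhit_def conv_def by (simp add: sweedler_image lin_scale)

text \<open>The matrix coefficient \<open>a \<mapsto> (\<phi>\<^sub>1 \<otimes> \<dots> \<otimes> \<phi>\<^sub>n)(a \<cdot> (m\<^sub>1 \<otimes> \<dots> \<otimes> m\<^sub>n))\<close> of a tensor power is the convolution product of the
  matrix coefficients of the factors. Lists of different lengths get the value zero, so that
  the statements below can quantify over all pairs of lists.\<close>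

fun coeff :: "('m \<Rightarrow> 'k) list \<Rightarrow> 'm list \<Rightarrow> 'a \<Rightarrow> 'k" where
  "coeff [] [] = counit"
| "coeff (\<phi> # \<phi>s) (m # ms) = conv (\<lambda>x. \<phi> (act x m)) (coeff \<phi>s ms)"
| "coeff _ _ = (\<lambda>_. 0)"

abbreviation functionals :: "('m \<Rightarrow> 'k) list \<Rightarrow> bool" where
  "functionals \<phi>s \<equiv> \<forall>\<phi>\<in>set \<phi>s. lin scaleM (*) \<phi>"

lemma lin_matrix_coeff: "lin scaleM (*) \<phi> \<Longrightarrow> lin scale (*) (\<lambda>x. \<phi> (act x m))"
  by (rule lin_compose[OF _ Mod.act_linear_left])

lemma lin_coeff: "functionals \<phi>s \<Longrightarrow> lin scale (*) (coeff \<phi>s ms)"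
proof (induction \<phi>s ms rule: coeff.induct)
  case 1 then show ?case by (simp add: lin_counit)
next
  case (2 \<phi> \<phi>s m ms) then show ?case by (auto intro!: lin_conv lin_matrix_coeff)
qed (auto intro!: linI vector_space_axioms vector_space_field)

lemma coeff_single: "lin scaleM (*) \<phi> \<Longrightarrow> coeff [\<phi>] [m] = (\<lambda>x. \<phi> (act x m))"
  by (auto simp: conv_counit_right lin_matrix_coeff)

lemma coeff_unequal_length: "length \<phi>s \<noteq> length ms \<Longrightarrow> coeff \<phi>s ms a = 0"
proof (induction \<phi>s ms arbitrary: a rule: coeff.induct)
  case (2 \<phi> \<phi>s m ms)
  then have "coeff \<phi>s ms = (\<lambda>_. 0)" by auto
  then show ?case by (simp add: conv_def sweedler_def lin_ext_def)
qed auto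

lemma coeff_append:
  assumes "length \<phi>s = length ms" "functionals \<phi>s" "functionals \<psi>s"
  shows "coeff (\<phi>s @ \<psi>s) (ms @ ns) a = conv (coeff \<phi>s ms) (coeff \<psi>s ns) a"
  using assms(1,2)
proof (induction \<phi>s ms arbitrary: a rule: list_induct2)
  case Nil
  then show ?case using conv_counit_left[OF lin_coeff[OF assms(3)], of 1 ns a] by simp
next
  case (Cons \<phi> \<phi>s m ms)
  then have "coeff (\<phi>s @ \<psi>s) (ms @ ns) = conv (coeff \<phi>s ms) (coeff \<psi>s ns)" by auto
  then show ?case
    using Cons.prems assms(3) by (simp add: conv_assoc lin_matrix_coeff lin_coeff)
qed

lemma lin_coeff_position:
  assumes "functionals \<phi>s"
  shows "lin scaleM (*) (\<lambda>v. coeff \<phi>s (us @ v # vs) a)"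
  using assms
proof (induction us arbitrary: \<phi>s a)
  case Nil
  show ?case
  proof (cases \<phi>s)
    case Nil
    then show ?thesis
      by (auto intro!: linI vector_space_field Mod.M.vector_space_axioms)
  next
    case (Cons \<phi> \<phi>s')
    have "lin scaleM (*) (\<lambda>v. sw (*) a (\<lambda>x y. \<phi> (act x v) * coeff \<phi>s' vs y))"
      using Nil.prems Cons
      by (intro lin_sweedler_fun vector_space_field Mod.M.vector_space_axioms lin_mult_right
          lin_compose[OF _ Mod.act_linear_right]) auto
    then show ?thesis using Cons by (simp add: conv_def)
  qed
next
  case (Cons u us)
  show ?case
  proof (cases \<phi>s)
    case Nil
    then show ?thesis
      by (auto intro!: linI vector_space_field Mod.M.vector_space_axioms)
  next
    fix \<phi> \<phi>s' assume \<phi>s: "\<phi>s = \<phi> # \<phi>s'"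
    have "lin scaleM (*) (\<lambda>v. sw (*) a (\<lambda>x y. \<phi> (act x u) * coeff \<phi>s' (us @ v # vs) y))"
      using Cons.prems \<phi>s
      by (intro lin_sweedler_fun vector_space_field Mod.M.vector_space_axioms lin_mult_left Cons.IH) auto
    then show ?thesis using \<phi>s by (simp add: conv_def)
  qed
qed

lemma pairing_diag_act:
  "lin_ext (*) (pairing \<phi>s) (diag_act comult counit act ms a) = coeff \<phi>s ms a"
proof (induction ms arbitrary: \<phi>s a)
  case Nil
  show ?case
    using lin_scale[OF linear_lin_ext[OF vector_space_field], of "pairing \<phi>s"]
    by (cases \<phi>s) (simp_all add: lin_ext_basic[OF vector_space_field])
next
  case (Cons m ms)
  note L = linear_lin_ext[OF vector_space_field, of "pairing \<phi>s"]
  have "lin_ext (*) (pairing \<phi>s) (diag_act comult counit act (m # ms) a) =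
      sw (*) a (\<lambda>x y. lin_ext (*) (\<lambda>l. pairing \<phi>s (act x m # l)) (diag_act comult counit act ms y))"
    by (simp add: sweedler_image[OF L] lin_ext_image[OF L vector_space_fscale]
        lin_ext_basic[OF vector_space_field])
  also have "\<dots> = coeff \<phi>s (m # ms) a"
  proof (cases \<phi>s)
    case Nil
    then show ?thesis by (simp add: lin_ext_zero_fun sweedler_def lin_ext_def)
  next
    fix \<phi> \<phi>s' assume "\<phi>s = \<phi> # \<phi>s'"
    then show ?thesis
      by (simp add: conv_def lin_ext_const_scale[OF vector_space_field] Cons.IH)
  qed
  finally show ?case .
qed

lemma diag_act_homogeneous: "diag_act comult counit act ms a \<in> homogeneous (length ms)"
proof (induction ms arbitrary: a)
  interpret F: vector_space "fscale :: 'k \<Rightarrow> ('m list \<Rightarrow>\<^sub>0 'k) \<Rightarrow> _" by (rule vector_space_fscale)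
  case Nil
  show ?case by (simp add: F.subspace_scale[OF subspace_homogeneous] homogeneous_basic)
next
  case (Cons m ms)
  then show ?case
    by (auto intro!: sweedler_mem[OF vector_space_fscale subspace_homogeneous]
        lin_ext_mem[OF vector_space_fscale subspace_homogeneous] homogeneous_basic)
       (simp add: homogeneous_def)
qed

text \<open>The matrix coefficients are linear in each \<open>m\<^sub>i\<close>, so the choice of representatives in the diagonal
  action does not matter, and they detect when the action is zero because pairings separate points.\<close>

lemma mem_tpow_Ann_iff:
  "a \<in> tpow_Ann comult counit scaleM act n \<longleftrightarrow>
    (\<forall>\<phi>s ms. length ms = n \<longrightarrow> functionals \<phi>s \<longrightarrow> coeff \<phi>s ms a = 0)" (is "?L \<longleftrightarrow> ?R")
proof
  let ?D = "lin_ext fscale (\<lambda>l. diag_act comult counit act l a)"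
  assume L: ?L
  show ?R
  proof (intro allI impI)
    fix \<phi>s and ms :: "'m list" assume len: "length ms = n" and \<phi>s: "functionals \<phi>s"
    let ?T = "tpow_class scaleM n (basic ms)"
    let ?c = "lin_ext (*) (\<lambda>l. coeff \<phi>s l a)"
    have "?T \<in> tpow_space scaleM n" using len by (auto simp: tpow_space_def)
    then have "?D (rep ?T) \<in> tpow_null scaleM n"
      using L tpow_class_eq_iff[of scaleM n "?D (rep ?T)" 0] by (auto simp: tpow_Ann_def tpow_act_def)
    then have "lin_ext (*) (pairing \<phi>s) (?D (rep ?T)) = 0" by (rule pairing_tpow_null[OF \<phi>s])
    then have "?c (rep ?T) = 0"
      using lin_ext_image[OF linear_lin_ext[OF vector_space_field, of "pairing \<phi>s"] vector_space_fscale,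
          of "\<lambda>l. diag_act comult counit act l a" "rep ?T"]
      by (simp add: pairing_diag_act)
    moreover have "?c (rep ?T - basic ms) = 0"
      using rep_tpow_class
      by (rule lin_ext_tpow_null[OF vector_space_field, rotated 2])
         (simp_all add: lin_add[OF lin_coeff_position[OF \<phi>s]] lin_scale[OF lin_coeff_position[OF \<phi>s]])
    ultimately show "coeff \<phi>s ms a = 0"
      by (simp add: lin_diff[OF linear_lin_ext[OF vector_space_field]] lin_ext_basic[OF vector_space_field])
  qed
next
  interpret F: vector_space "fscale :: 'k \<Rightarrow> ('m list \<Rightarrow>\<^sub>0 'k) \<Rightarrow> _" by (rule vector_space_fscale)
  let ?D = "lin_ext fscale (\<lambda>l. diag_act comult counit act l a)"
  assume R: ?R
  show ?L
    unfolding tpow_Ann_def mem_Collect_eq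
  proof
    fix T assume "T \<in> tpow_space scaleM n"
    then obtain x where x: "x \<in> homogeneous n" and T: "T = tpow_class scaleM n x"
      by (auto simp: tpow_space_def homogeneous_def)
    have "(rep T - x) + x \<in> homogeneous n"
      using x rep_tpow_class[of scaleM n x] tpow_null_homogeneous[of scaleM n] T
      by (intro F.subspace_add[OF subspace_homogeneous]) auto
    then have "length l = n" if "l \<in> Poly_Mapping.keys (rep T)" for l
      using that by (simp add: homogeneous_def)
    moreover have "diag_act comult counit act l a \<in> tpow_null scaleM n" if "length l = n" for l
      using diag_act_homogeneous[of l a] that R
      by (intro M.tpow_null_if_pairings_vanish) (auto simp: pairing_diag_act)
    ultimately have "?D (rep T) \<in> tpow_null scaleM n"
      by (intro lin_ext_mem[OF vector_space_fscale subspace_tpow_null]) auto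
    then show "tpow_act comult counit scaleM act n a T = tpow_class scaleM n 0"
      by (simp add: tpow_act_def tpow_class_eq_iff)
  qed
qed

text \<open>Contracting the defining equation in \<open>A \<otimes> M\<close> with all functionals on \<open>M\<close> shows that the left kernel
  consists of the elements that are coinvariant with respect to the matrix coefficients of \<open>M\<close>, for
  which \<open>\<phi>(m)\<close> is the value at \<open>1\<close>.\<close>

lemma mem_LKer_iff:
  "a \<in> LKer scale comult scaleM act \<longleftrightarrow>
    (\<forall>\<phi> m. lin scaleM (*) \<phi> \<longrightarrow> hit (\<lambda>x. \<phi> (act x m)) a = scale (\<phi> m) a)"
proof -
  let ?u = "\<lambda>m. sweedler fscale (comult a) (\<lambda>x y. basic (x, act y m))"
  let ?G = "\<lambda>\<phi>. lin_ext scale (\<lambda>(x, m). scale (\<phi> m) x)"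
  have G: "?G \<phi> (?u m - basic (a, m)) = hit (\<lambda>x. \<phi> (act x m)) a - scale (\<phi> m) a" for \<phi> m
  proof -
    note L = linear_lin_ext[OF vector_space_axioms, of "\<lambda>(x, m). scale (\<phi> m) x"]
    show ?thesis
      by (simp add: lin_diff[OF L] sweedler_image[OF L] lin_ext_basic[OF vector_space_axioms] hit_def)
  qed
  have "a \<in> LKer scale comult scaleM act \<longleftrightarrow> (\<forall>m. ?u m - basic (a, m) \<in> tensor_null scale scaleM)"
    by (simp add: LKer_def tensor_class_eq_iff)
  also have "\<dots> \<longleftrightarrow> (\<forall>\<phi> m. lin scaleM (*) \<phi> \<longrightarrow> ?G \<phi> (?u m - basic (a, m)) = 0)"
  proof (intro iffI allI impI)
    fix \<phi> m assume A: "\<forall>m. ?u m - basic (a, m) \<in> tensor_null scale scaleM" and \<phi>: "lin scaleM (*) \<phi>"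
    have "?G \<phi> (?u m - basic (a, m)) \<in> {0}"
      by (rule lin_ext_tensor_null[OF vector_space_axioms subspace_zero[OF vector_space_axioms] _ _ _ _ A[rule_format]])
         (simp_all add: lin_add[OF \<phi>] lin_scale[OF \<phi>] scale_right_distrib scale_left_distrib mult.commute)
    then show "?G \<phi> (?u m - basic (a, m)) = 0" by simp
  next
    fix m assume "\<forall>\<phi> m. lin scaleM (*) \<phi> \<longrightarrow> ?G \<phi> (?u m - basic (a, m)) = 0"
    then show "?u m - basic (a, m) \<in> tensor_null scale scaleM"
      by (intro M.tensor_null_if_contractions_vanish vector_space_axioms) blast
  qed
  finally show ?thesis by (simp only: G right_minus_eq)
qed

section \<open>The common annihilator of the tensor powers\<close>

definition annihilator :: "'a set" where
  "annihilator = (\<Inter>n. tpow_Ann comult counit scaleM act n)"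

lemma mem_annihilator_iff:
  "a \<in> annihilator \<longleftrightarrow> (\<forall>\<phi>s ms. functionals \<phi>s \<longrightarrow> coeff \<phi>s ms a = 0)"
  by (auto simp: annihilator_def mem_tpow_Ann_iff)

definition Ann :: "nat \<Rightarrow> 'a set" where
  "Ann n = tpow_Ann comult counit scaleM act n"

text \<open>The matrix coefficient of a longer tensor product at \<open>a\<close> is one of a shorter product at \<open>a \<leftharpoonup> c\<close>: this
  is contraction in the first tensor factor, and it drives the induction below.\<close>

lemma lhit_Ann:
  assumes a: "a \<in> Ann (Suc n)" and \<phi>: "lin scaleM (*) \<phi>"
  shows "lhit (\<lambda>x. \<phi> (act x m)) a \<in> Ann n"
  unfolding Ann_def mem_tpow_Ann_iff
proof (intro allI impI)
  fix \<psi>s and ns :: "'m list" assume "length ns = n" and \<psi>s: "functionals \<psi>s"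
  then have "length (m # ns) = Suc n" "functionals (\<phi> # \<psi>s)" using \<phi> by simp_all
  then have "coeff (\<phi> # \<psi>s) (m # ns) a = 0"
    using a unfolding Ann_def mem_tpow_Ann_iff by blast
  then show "coeff \<psi>s ns (lhit (\<lambda>x. \<phi> (act x m)) a) = 0"
    by (simp add: apply_lhit[OF lin_coeff[OF \<psi>s]])
qed

text \<open>Since \<open>\<Delta>\<close> is multiplicative, \<open>b\<close> acts on the first tensor factor and on the remaining ones separately. In
  the first factor it only changes the functional or the vector with which \<open>a\<close> is contracted; in the
  others it is absorbed by the induction hypothesis.\<close>

lemma Ann_ideal:
  assumes "a \<in> Ann n"
  shows "b * a \<in> Ann n \<and> a * b \<in> Ann n"
  using assms
proof (induction n arbitrary: a b)
  case 0
  then have "counit a = 0"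
    unfolding Ann_def mem_tpow_Ann_iff by (auto dest: spec[of _ "[]"])
  then have "coeff \<phi>s [] (b * a) = 0 \<and> coeff \<phi>s [] (a * b) = 0" for \<phi>s
    by (cases \<phi>s) (simp_all add: counit_mult)
  then show ?case by (auto simp: Ann_def mem_tpow_Ann_iff)
next
  case (Suc n)
  have step: "coeff (\<phi> # \<phi>s) (m # ms) (b * a) = 0 \<and> coeff (\<phi> # \<phi>s) (m # ms) (a * b) = 0"
    if len: "length ms = n" and \<phi>: "lin scaleM (*) \<phi>" and \<phi>s: "functionals \<phi>s" for \<phi> \<phi>s m ms
  proof
    let ?f = "coeff \<phi>s ms"
    note f = lin_coeff[OF \<phi>s, of ms] and c = lin_matrix_coeff[OF \<phi>, of m]
    note li = lin_intros lin_compose[OF f] lin_compose[OF c]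
    have mem: "?f x = 0" if "x \<in> Ann n" for x
      using that len \<phi>s unfolding Ann_def mem_tpow_Ann_iff by blast
    have contract: "sw (*) a (\<lambda>p q. \<psi> (act p v) * g q) = 0"
      if "lin scaleM (*) \<psi>" "lin scale (*) g" "\<And>x. x \<in> Ann n \<Longrightarrow> g x = 0" for \<psi> v g
      using that(3)[OF lhit_Ann[OF Suc.prems that(1), of v]] by (simp add: apply_lhit[OF that(2)] conv_def)
    have "coeff (\<phi> # \<phi>s) (m # ms) (b * a) =
        sw (*) b (\<lambda>x y. sw (*) a (\<lambda>p q. \<phi> (act (x * p) m) * ?f (y * q)))"
      unfolding coeff.simps conv_def by (rule sw_mult) (intro li)+
    also have "\<dots> = sw (*) b (\<lambda>x y. 0)"
    proof -
      have "sw (*) a (\<lambda>p q. \<phi> (act (x * p) m) * ?f (y * q)) = 0" for x y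
        unfolding Mod.act_mult
        using Suc.IH mem
        by (intro contract[of "\<lambda>v. \<phi> (act x v)"] lin_compose[OF \<phi> Mod.act_linear_right] li) auto
      then show ?thesis by simp
    qed
    finally show "coeff (\<phi> # \<phi>s) (m # ms) (b * a) = 0" by (simp add: sweedler_def lin_ext_def)
    have "coeff (\<phi> # \<phi>s) (m # ms) (a * b) =
        sw (*) a (\<lambda>x y. sw (*) b (\<lambda>p q. \<phi> (act (x * p) m) * ?f (y * q)))"
      unfolding coeff.simps conv_def by (rule sw_mult) (intro li)+
    also have "\<dots> = sw (*) b (\<lambda>p q. sw (*) a (\<lambda>x y. \<phi> (act x (act p m)) * ?f (y * q)))"
      unfolding Mod.act_mult by (rule sweedler_swap) (rule vector_space_field)
    also have "\<dots> = sw (*) b (\<lambda>p q. 0)"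
    proof -
      have "sw (*) a (\<lambda>x y. \<phi> (act x (act p m)) * ?f (y * q)) = 0" for p q
        using Suc.IH mem by (intro contract \<phi> li) auto
      then show ?thesis by simp
    qed
    finally show "coeff (\<phi> # \<phi>s) (m # ms) (a * b) = 0" by (simp add: sweedler_def lin_ext_def)
  qed
  have "coeff \<phi>s ms (b * a) = 0 \<and> coeff \<phi>s ms (a * b) = 0"
    if "length ms = Suc n" "functionals \<phi>s" for \<phi>s ms
    using that step by (cases \<phi>s; cases ms) auto
  then show ?case
    by (simp_all add: Ann_def mem_tpow_Ann_iff)
qed

text \<open>Concatenating lists shows that the matrix coefficients are closed under convolution. Hence
  \<open>v \<rightharpoonup> x\<close> stays in the annihilator for every matrix coefficient \<open>v\<close>. Pairing this with \<open>f\<close> shows that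
  \<open>x \<leftharpoonup> f\<close> lies in the annihilator, and it remains to pair with \<open>g\<close>.\<close>

lemma annihilator_coideal:
  assumes f: "lin scale (*) f" "\<And>x. x \<in> annihilator \<Longrightarrow> f x = 0"
    and g: "lin scale (*) g" "\<And>x. x \<in> annihilator \<Longrightarrow> g x = 0"
    and x: "x \<in> annihilator"
  shows "conv f g x = 0"
proof -
  have hit: "hit (coeff \<psi>s ns) x \<in> annihilator" if \<psi>s: "functionals \<psi>s" for \<psi>s ns
    unfolding mem_annihilator_iff
  proof (intro allI impI)
    fix \<phi>s and ms :: "'m list" assume \<phi>s: "functionals \<phi>s"
    show "coeff \<phi>s ms (hit (coeff \<psi>s ns) x) = 0"
    proof (cases "length \<phi>s = length ms")
      case True
      have "functionals (\<phi>s @ \<psi>s)" using \<phi>s \<psi>s by auto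
      then have "coeff (\<phi>s @ \<psi>s) (ms @ ns) x = 0"
        using x unfolding mem_annihilator_iff by blast
      then show ?thesis
        by (simp add: apply_hit[OF lin_coeff[OF \<phi>s]] coeff_append[OF True \<phi>s \<psi>s])
    qed (simp add: coeff_unequal_length)
  qed
  have "lhit f x \<in> annihilator"
    unfolding mem_annihilator_iff
  proof (intro allI impI)
    fix \<psi>s and ns :: "'m list" assume \<psi>s: "functionals \<psi>s"
    show "coeff \<psi>s ns (lhit f x) = 0"
      using f(2)[OF hit[OF \<psi>s]] by (simp add: apply_lhit[OF lin_coeff[OF \<psi>s]] apply_hit[OF f(1)])
  qed
  from g(2)[OF this] show ?thesis by (simp add: apply_lhit[OF g(1)])
qed

lemma subspace_annihilator: "subspace annihilator"
  unfolding subspace_def Ball_def mem_annihilator_iff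
  by (simp add: lin_zero[OF lin_coeff] lin_add[OF lin_coeff] lin_scale[OF lin_coeff])

lemma annihilator_ideal:
  "x \<in> annihilator \<Longrightarrow> b * x \<in> annihilator" "x \<in> annihilator \<Longrightarrow> x * b \<in> annihilator"
  using Ann_ideal[of x _ b] by (auto simp: annihilator_def Ann_def)

lemma bi_ideal_annihilator: "bi_ideal scale comult counit antipode annihilator BasA"
proof (rule bi_ideal.intro[OF hopf_algebra_axioms bi_ideal_axioms.intro])
  show "counit x = 0" if "x \<in> annihilator" for x
    using that[unfolded mem_annihilator_iff, rule_format, of "[]" "[]"] by simp
  show "sw (*) x (\<lambda>p q. f p * g q) = 0" if "lin scale (*) f" "lin scale (*) g"
    "\<And>x. x \<in> annihilator \<Longrightarrow> f x = 0" "\<And>x. x \<in> annihilator \<Longrightarrow> g x = 0" "x \<in> annihilator" for f g x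
    using annihilator_coideal[OF that(1,3,2,4,5)] by (simp add: conv_def)
qed (fact fin_dim_A subspace_annihilator annihilator_ideal)+

text \<open>If \<open>b\<close> is in the left kernel, then \<open>c \<rightharpoonup> b = c(1) b\<close> for every matrix coefficient \<open>c\<close> of \<open>M\<close>, so the last
  factor of a product of matrix coefficients can be split off as a scalar. What is left in the end is
  a multiple of \<open>\<epsilon>(b) = 0\<close>.\<close>

lemma omega_LKer_subset_annihilator:
  "omega counit (LKer scale comult scaleM act) \<subseteq> annihilator"
proof
  fix b assume b: "b \<in> omega counit (LKer scale comult scaleM act)"
  have "coeff \<phi>s ms b = 0" if "functionals \<phi>s" for \<phi>s ms
    using that
  proof (induction ms arbitrary: \<phi>s rule: rev_induct)
    case Nil
    then show ?case using b by (cases \<phi>s) (auto simp: omega_def)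
  next
    case (snoc m ms)
    show ?case
    proof (cases "length \<phi>s = length (ms @ [m])")
      case True
      then obtain \<phi>s' \<phi> where \<phi>s: "\<phi>s = \<phi>s' @ [\<phi>]" by (cases \<phi>s rule: rev_cases) auto
      have \<phi>: "lin scaleM (*) \<phi>" and \<phi>s': "functionals \<phi>s'" using snoc.prems \<phi>s by auto
      have "coeff \<phi>s (ms @ [m]) b = conv (coeff \<phi>s' ms) (coeff [\<phi>] [m]) b"
        unfolding \<phi>s using True \<phi>s \<phi> \<phi>s' by (intro coeff_append) auto
      also have "\<dots> = coeff \<phi>s' ms (hit (\<lambda>x. \<phi> (act x m)) b)"
        by (simp only: coeff_single[OF \<phi>] apply_hit[OF lin_coeff[OF \<phi>s']])
      also have "\<dots> = 0"
        using b \<phi> snoc.IH[OF \<phi>s'] by (simp add: omega_def mem_LKer_iff lin_scale[OF lin_coeff[OF \<phi>s']])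
      finally show ?thesis .
    qed (rule coeff_unequal_length)
  qed
  then show "b \<in> annihilator" by (simp add: mem_annihilator_iff)
qed

text \<open>Matrix coefficients of \<open>M\<close> vanish on the annihilator, so elements that are coinvariant for the quotient
  by the annihilator lie in the left kernel. With this, one inclusion is
  \<open>bi_ideal_subset_coinvariants\<close>; the other holds because the annihilator is a right ideal.\<close>

theorem annihilator_eq:
  "annihilator = subspace_mult scale (omega counit (LKer scale comult scaleM act)) UNIV"
proof
  interpret bi_ideal scale comult counit antipode annihilator BasA
    by (rule bi_ideal_annihilator)
  let ?B = "LKer scale comult scaleM act"
  show "subspace_mult scale (omega counit ?B) UNIV \<subseteq> annihilator"
    unfolding subspace_mult_def
    using omega_LKer_subset_annihilator annihilator_ideal(2)
    by (intro span_minimal subspace_annihilator) auto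
  obtain C e where C: "finite C \<and> (\<forall>c\<in>C. lin scale (*) (e c)) \<and> (\<forall>c\<in>C. \<forall>x\<in>annihilator. e c x = 0) \<and>
      (\<forall>x. x - (\<Sum>c\<in>C. scale (e c x) c) \<in> annihilator)"
    using coordinates_modulo_subspace[OF fin_dim_A subspace_annihilator] by (elim exE)
  interpret bi_ideal_coords scale comult counit antipode annihilator BasA C e
  proof (rule bi_ideal_coords.intro[OF bi_ideal_annihilator bi_ideal_coords_axioms.intro])
    show "lin scale (*) (e c)" if "c \<in> C" for c
      using C that by blast
    show "e c x = 0" if "c \<in> C" "x \<in> annihilator" for c x
      using C that by blast
    show "x - (\<Sum>c\<in>C. scale (e c x) c) \<in> annihilator" for x
      using C by blast
  qed
  have "b \<in> omega counit ?B" if "counit b = 0" "\<forall>f. perp f \<longrightarrow> hit f b = scale (f 1) b" for b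
  proof -
    have "perp (\<lambda>x. \<phi> (act x m))" if \<phi>: "lin scaleM (*) \<phi>" for \<phi> m
    proof -
      have "functionals [\<phi>]" using \<phi> by simp
      then have "coeff [\<phi>] [m] x = 0" if "x \<in> annihilator" for x
        using that unfolding mem_annihilator_iff by blast
      then show ?thesis
        unfolding coeff_single[OF \<phi>] by (simp add: perp_def lin_matrix_coeff[OF \<phi>])
    qed
    then show ?thesis
      using that by (auto simp: omega_def mem_LKer_iff Mod.act_one)
  qed
  then have "{b * y | b y. counit b = 0 \<and> (\<forall>f. perp f \<longrightarrow> hit f b = scale (f 1) b)} \<subseteq>
      {x * y | x y. x \<in> omega counit ?B \<and> y \<in> UNIV}" by blast
  then show "annihilator \<subseteq> subspace_mult scale (omega counit ?B) UNIV"
    unfolding subspace_mult_def using bi_ideal_subset_coinvariants span_mono by blast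
qed

end

theorem corollary2p3p7:
  fixes scale :: "'k::field \<Rightarrow> 'a::ring_1 \<Rightarrow> 'a"
    and comult :: "'a \<Rightarrow> ('a \<times> 'a \<Rightarrow>\<^sub>0 'k) set"
    and counit :: "'a \<Rightarrow> 'k"
    and antipode :: "'a \<Rightarrow> 'a"
    and scaleM :: "'k \<Rightarrow> 'm::ab_group_add \<Rightarrow> 'm"
    and act :: "'a \<Rightarrow> 'm \<Rightarrow> 'm"
  assumes "hopf_algebra scale comult counit antipode"
    and "\<exists>B. finite_dimensional_vector_space scale B"
    and "left_module scale scaleM act"
    and "\<exists>B. finite_dimensional_vector_space scaleM B"
  shows "(\<Inter>n. tpow_Ann comult counit scaleM act n) =
         subspace_mult scale (omega counit (LKer scale comult scaleM act)) UNIV"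
proof -
  obtain BasA BasM where "finite_dimensional_vector_space scale BasA"
    "finite_dimensional_vector_space scaleM BasM"
    using assms(2,4) by blast
  then interpret hopf_module scale comult counit antipode scaleM act BasA BasM
    using assms(1,3) by (simp add: hopf_module_def hopf_module_axioms_def)
  show ?thesis using annihilator_eq by (simp add: annihilator_def)
qed

end
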